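(* Let $t>0$. For an even Schwartz function $h:\mathbb{R}^n\to\mathbb{R}$, consider the conditions: (i$'$) $h(x)\ge e^{-t\|x\|^2}$ for every stable lattice $\Lambda\subset\mathbb{R}^n$ and every $x\in\Lambda\setminus\{0\}$; (ii$'$) $\widehat h(\xi)\le 0$ for every stable lattice $\Lambda\subset\mathbb{R}^n$ and every $\xi\in\Lambda^*\setminus\{0\}$. Then the following hold. (1) If $n\ge 4$, $h$ satisfies (i$'$) and (ii$'$), and $1+\widehat h(0)-h(0)=\Theta_{\mathbb{Z}^n}(t)$, then $h(x)=e^{-t\|x\|^2}$ and $\widehat h(x)=0$ for every $x\in\mathbb{R}^n$ with $x\ne 0$ and $\|x\|^2\in\mathbb{Z}$. (2) If $n\ge 8$ and $h$ satisfies (i$'$) and (ii$'$), then $1+\widehat h(0)-h(0)>\Theta_{\mathbb{Z}^n}(t)$. (3) If $n\ge 8$, there is no even Schwartz function $h:\mathbb{R}^n\to\mathbb{R}$ satisfying (i$'$), (ii$'$) and $1+\widehat h(0)-h(0)=\Theta_{\mathbb{Z}^n}(t)$.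
   Context: A full-rank lattice $\Lambda\subset\mathbb{R}^n$ is stable if $\operatorname{covol}(\Lambda)=1$ and every nonzero sublattice $\Lambda'\subseteq\Lambda$ (of any rank) has covolume at least $1$ in its linear span; equivalently, if $v_1,\dots,v_r$ is a basis of $\Lambda'$, then $\sqrt{\det(\langle v_i,v_j\rangle)_{i,j=1}^r}\ge 1$. The dual lattice is $\Lambda^*=\{\xi\in\mathbb{R}^n:\langle x,\xi\rangle\in\mathbb{Z}\text{ for all }x\in\Lambda\}$. The Gaussian mass of $\Lambda$ is $\Theta_\Lambda(t)=\sum_{x\in\Lambda}e^{-t\|x\|^2}$ for $t>0$. The Fourier transform is $\widehat f(\xi)=\int_{\mathbb{R}^n}f(x)e^{-2\pi i\langle x,\xi\rangle}\,dx$; for $h$ real and even, $\widehat h$ is real-valued. *)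

theory Defs
  imports "HOL-Analysis.Analysis" "Jordan_Normal_Form.Determinant"
begin

definition int_span :: "'a::real_vector list \<Rightarrow> 'a set" where
  "int_span vs = range (\<lambda>c :: nat \<Rightarrow> int. \<Sum>i<length vs. of_int (c i) *\<^sub>R vs ! i)"

definition lattice_basis :: "'a::real_vector list \<Rightarrow> 'a set \<Rightarrow> bool" where
  "lattice_basis vs L \<longleftrightarrow> distinct vs \<and> independent (set vs) \<and> L = int_span vs"

text \<open>A lattice may have any rank here, including \<open>0\<close>.\<close>

definition is_lattice :: "'a::real_vector set \<Rightarrow> bool" where
  "is_lattice L \<longleftrightarrow> (\<exists>vs. lattice_basis vs L)"

definition full_rank_lattice :: "'a::real_vector set \<Rightarrow> bool" where
  "full_rank_lattice L \<longleftrightarrow> is_lattice L \<and> span L = UNIV"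

text \<open>The prefix form \<^term>\<open>inner\<close> and the qualified \<^const>\<open>Determinant.det\<close> avoid the clash
  between the vectors and matrices of \<open>HOL-Analysis\<close> and those of \<open>Jordan_Normal_Form\<close>; the
  latter are used because the rank of a sublattice varies.\<close>

definition gram_det :: "'a::real_inner list \<Rightarrow> real" where
  "gram_det vs = Determinant.det
     (Matrix.mat (length vs) (length vs) (\<lambda>(i, j). inner (vs ! i) (vs ! j)))"

text \<open>The covolume of a lattice in its linear span. The choice of basis is immaterial, see
  \<open>covol_eq\<close> below.\<close>

definition covol :: "'a::real_inner set \<Rightarrow> real" where
  "covol L = sqrt (gram_det (SOME vs. lattice_basis vs L))"

text \<open>Every additive subgroup of a lattice is again a lattice, so the sublattices of \<open>L\<close> are the
  lattices contained in \<open>L\<close>.\<close>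

definition stable :: "'a::real_inner set \<Rightarrow> bool" where
  "stable L \<longleftrightarrow> full_rank_lattice L \<and> covol L = 1 \<and>
     (\<forall>M. is_lattice M \<and> M \<subseteq> L \<and> M \<noteq> {0} \<longrightarrow> covol M \<ge> 1)"

definition dual_lattice :: "'a::real_inner set \<Rightarrow> 'a set" where
  "dual_lattice L = {\<xi>. \<forall>x\<in>L. inner x \<xi> \<in> \<int>}"

definition standard_lattice :: "(real ^ 'n) set" where
  "standard_lattice = {x. \<forall>i. vec_nth x i \<in> \<int>}"

definition gaussian_mass :: "'a::real_normed_vector set \<Rightarrow> real \<Rightarrow> real" where
  "gaussian_mass L t = (\<Sum>\<^sub>\<infinity>x\<in>L. exp (- t * (norm x)\<^sup>2))"

lemma covol_eq:
  fixes vs :: "'a::real_inner list"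
  assumes "lattice_basis vs L"
  shows "covol L = sqrt (gram_det vs)"
proof -
  have expand: "\<exists>U :: nat \<Rightarrow> nat \<Rightarrow> int. \<forall>j<length b. b ! j = (\<Sum>i<length a. of_int (U i j) *\<^sub>R a ! i)"
    if "lattice_basis a L" "lattice_basis b L" for a b :: "'a list"
  proof -
    have "\<exists>c :: nat \<Rightarrow> int. b ! j = (\<Sum>i<length a. of_int (c i) *\<^sub>R a ! i)" if j: "j < length b" for j
    proof -
      have "b ! j = (\<Sum>i<length b. of_int (if i = j then 1 else 0) *\<^sub>R b ! i)"
        using j by (simp add: if_distrib[of of_int] if_distrib[of "\<lambda>x. x *\<^sub>R _"] sum.delta cong: if_cong)
      then have "b ! j \<in> int_span b"
        unfolding int_span_def by (intro image_eqI[where x = "\<lambda>i. if i = j then 1 else 0"]) auto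
      then show ?thesis
        using \<open>lattice_basis a L\<close> \<open>lattice_basis b L\<close> unfolding lattice_basis_def int_span_def by auto
    qed
    then obtain c :: "nat \<Rightarrow> nat \<Rightarrow> int"
      where "\<And>j. j < length b \<Longrightarrow> b ! j = (\<Sum>i<length a. of_int (c j i) *\<^sub>R a ! i)"
      by metis
    then show ?thesis by (intro exI[of _ "\<lambda>i j. c j i"]) auto
  qed
  have sub: "set b \<subseteq> span (set a)"
    if "lattice_basis a L" "lattice_basis b L" for a b :: "'a list"
  proof
    fix x assume "x \<in> set b"
    then obtain j where "j < length b" "x = b ! j" by (auto simp: in_set_conv_nth)
    with expand[OF that] obtain U :: "nat \<Rightarrow> nat \<Rightarrow> int"
      where "x = (\<Sum>i<length a. of_int (U i j) *\<^sub>R a ! i)" by auto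
    also have "\<dots> \<in> span (set a)"
      by (intro span_sum span_scale span_base) simp
    finally show "x \<in> span (set a)" .
  qed
  have len: "length a = length b"
    if ab: "lattice_basis a L" "lattice_basis b L" for a b :: "'a list"
  proof -
    have "dim (set a) = dim (set b)"
      using sub[OF ab] sub[OF ab(2,1)] by (metis span_eq dim_span)
    then show ?thesis
      using ab unfolding lattice_basis_def by (metis dim_eq_card_independent distinct_card)
  qed
  have gram: "\<exists>m :: int. m \<ge> 0 \<and> gram_det b = of_int m * gram_det a"
    if ab: "lattice_basis a L" "lattice_basis b L" for a b :: "'a list"
  proof -
    define n where "n = length a"
    have nb: "length b = n" using len[OF ab] n_def by simp
    obtain U :: "nat \<Rightarrow> nat \<Rightarrow> int"
      where U: "\<And>j. j < n \<Longrightarrow> b ! j = (\<Sum>i<n. of_int (U i j) *\<^sub>R a ! i)"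
      using expand[OF ab] nb n_def by auto
    define UI where "UI = Matrix.mat n n (\<lambda>(i, j). U i j)"
    define UR where "UR = Matrix.mat n n (\<lambda>(i, j). real_of_int (U i j))"
    define Ga where "Ga = Matrix.mat n n (\<lambda>(i, j). inner (a ! i) (a ! j))"
    define Gb where "Gb = Matrix.mat n n (\<lambda>(i, j). inner (b ! i) (b ! j))"
    have car: "UR \<in> carrier_mat n n" "Ga \<in> carrier_mat n n" "transpose_mat UR \<in> carrier_mat n n"
      by (simp_all add: UR_def Ga_def)
    have "Gb = transpose_mat UR * (Ga * UR)"
    proof (rule eq_matI)
      fix i j assume "i < dim_row (transpose_mat UR * (Ga * UR))" "j < dim_col (transpose_mat UR * (Ga * UR))"
      then have ij: "i < n" "j < n" by (simp_all add: UR_def)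
      then show "Gb $$ (i, j) = (transpose_mat UR * (Ga * UR)) $$ (i, j)"
        by (simp add: Gb_def Ga_def UR_def U scalar_prod_def inner_sum_left inner_sum_right
            sum_distrib_left atLeast0LessThan mult_ac)
    qed (simp_all add: Gb_def UR_def)
    then have "Determinant.det Gb = Determinant.det UR * (Determinant.det Ga * Determinant.det UR)"
      using car by (simp add: Determinant.det_mult[of _ n] Determinant.det_transpose[of _ n])
    moreover have "UR = map_mat real_of_int UI"
      by (auto simp: UR_def UI_def)
    then have "Determinant.det UR = of_int (Determinant.det UI)"
      by (simp add: of_int_hom.hom_det)
    ultimately have "Determinant.det Gb = of_int (Determinant.det UI ^ 2) * Determinant.det Ga"
      by (simp add: power2_eq_square)
    moreover have "gram_det a = Determinant.det Ga" "gram_det b = Determinant.det Gb"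
      by (simp_all add: gram_det_def Ga_def Gb_def n_def[symmetric] nb)
    ultimately show ?thesis by (intro exI[of _ "Determinant.det UI ^ 2"]) auto
  qed
  have key: "gram_det a = gram_det b"
    if ab: "lattice_basis a L" "lattice_basis b L" for a b :: "'a list"
  proof (cases "gram_det a = 0")
    case True
    then show ?thesis using gram[OF ab] by auto
  next
    case False
    obtain m :: int where m: "m \<ge> 0" "gram_det b = of_int m * gram_det a"
      using gram[OF ab] by blast
    obtain k :: int where k: "gram_det a = of_int k * gram_det b"
      using gram[OF ab(2,1)] by blast
    have "of_int (m * k) * gram_det a = of_int k * gram_det b"
      unfolding m(2) by simp
    also have "\<dots> = 1 * gram_det a"
      unfolding k[symmetric] by simp
    finally have "real_of_int (m * k) = 1"
      using False by (simp only: mult_right_cancel[OF False])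
    then have "m * k = 1"
      by (simp only: of_int_eq_1_iff)
    with m(1) have "m = 1" by (auto simp: zmult_eq_1_iff)
    then show ?thesis using m(2) by simp
  qed
  have "lattice_basis (SOME vs. lattice_basis vs L) L"
    using assms by (rule someI)
  then show ?thesis unfolding covol_def using key[OF assms] by simp
qed

fun iter_deriv :: "'a::euclidean_space list \<Rightarrow> ('a \<Rightarrow> real) \<Rightarrow> 'a \<Rightarrow> real" where
  "iter_deriv [] f = f"
| "iter_deriv (b # bs) f = (\<lambda>x. frechet_derivative (iter_deriv bs f) (at x) b)"

text \<open>All iterated partial derivatives are (totally) differentiable, which says that \<open>f\<close> is smooth,
  and decay faster than any power of the norm.\<close>

definition schwartz :: "('a::euclidean_space \<Rightarrow> real) \<Rightarrow> bool" where
  "schwartz f \<longleftrightarrow> (\<forall>bs\<in>lists Basis.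
     (\<forall>x. iter_deriv bs f differentiable (at x)) \<and>
     (\<forall>k::nat. bounded (range (\<lambda>x. norm x ^ k * iter_deriv bs f x))))"

definition even_fun :: "('a::real_vector \<Rightarrow> real) \<Rightarrow> bool" where
  "even_fun f \<longleftrightarrow> (\<forall>x. f (- x) = f x)"

definition fourier :: "('a::euclidean_space \<Rightarrow> real) \<Rightarrow> 'a \<Rightarrow> complex" where
  "fourier f \<xi> = (LINT x|lborel. complex_of_real (f x) * exp (- 2 * pi * \<i> * inner x \<xi>))"

text \<open>In the situation of interest \<^const>\<open>fourier\<close> takes real values, so that passing to its real
  part in inequalities loses nothing.\<close>

lemma fourier_real:
  assumes "schwartz f" "even_fun f"
  shows "fourier f \<xi> \<in> \<real>"
proof -
  have "iter_deriv [] f differentiable (at x)" for x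
    using assms(1) unfolding schwartz_def by (metis lists.Nil)
  then have "continuous_on UNIV f"
    by (simp add: continuous_at_imp_continuous_on differentiable_imp_continuous_within)
  then have [measurable]: "f \<in> borel_measurable borel"
    by (rule borel_measurable_continuous_onI)
  let ?g = "\<lambda>x. complex_of_real (f x) * exp (- 2 * pi * \<i> * inner x \<xi>)"
  have "distr lborel borel uminus = (lborel :: 'a measure)"
    using lborel_affine[of "- 1" "0 :: 'a"] by (simp add: density_1)
  then have "fourier f \<xi> = (LINT x|distr lborel borel uminus. ?g x)"
    unfolding fourier_def by simp
  also have "\<dots> = (LINT x|lborel. ?g (- x))"
    by (rule integral_distr) measurable
  also have "\<dots> = (LINT x|lborel. cnj (?g x))"
    using assms(2) by (simp add: even_fun_def exp_cnj)
  also have "\<dots> = cnj (fourier f \<xi>)"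
    unfolding fourier_def by (rule Bochner_Integration.integral_cnj)
  finally show ?thesis by (simp add: Reals_cnj_iff)
qed

definition dominates_gaussian :: "real \<Rightarrow> ('a::euclidean_space \<Rightarrow> real) \<Rightarrow> bool" where
  "dominates_gaussian t h \<longleftrightarrow>
     (\<forall>L x. stable L \<and> x \<in> L - {0} \<longrightarrow> h x \<ge> exp (- t * (norm x)\<^sup>2))"

definition fourier_nonpos :: "('a::euclidean_space \<Rightarrow> real) \<Rightarrow> bool" where
  "fourier_nonpos h \<longleftrightarrow>
     (\<forall>L \<xi>. stable L \<and> \<xi> \<in> dual_lattice L - {0} \<longrightarrow> Re (fourier h \<xi>) \<le> 0)"

end

theory Submission
  imports Defs "HOL-Computational_Algebra.Primes" "HOL-Probability.Sinc_Integral"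
begin

text \<open>Every rotation of \<open>\<int>\<^sup>n\<close> is stable and self-dual, so Poisson summation over it together with
  (i') and (ii') gives \<open>\<Theta> \<le> 1 + h^(0) - h(0)\<close>, and equality forces equality in every single term. By the four-square
  theorem the rotations of \<open>\<int>\<^sup>n\<close> cover all vectors of integer square norm once \<open>n \<ge> 4\<close>, which is (1).

  For \<open>n \<ge> 8\<close>, twist the Poisson sum over \<open>\<int>\<^sup>n\<close> by the sign character \<open>(-1)\<^bsup>x\<^sub>1 + ... + x\<^sub>k\<^esup>\<close> with \<open>k = 4\<close>
  or \<open>k = 8\<close>. This shifts the Fourier side to nonzero vectors of integer square norm, where by (1) everything
  vanishes, and on the other side all terms but the one at \<open>0\<close> are Gaussian. With
  \<open>\<theta>\<^sub>3 = \<Sum> e\<^bsup>-tm\<^sup>2\<^esup>\<close> and \<open>\<theta>\<^sub>4 = \<Sum> (-1)\<^sup>m e\<^bsup>-tm\<^sup>2\<^esup>\<close> this reads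
  \<open>\<theta>\<^sub>4\<^sup>k \<theta>\<^sub>3\<^bsup>n-k\<^esup> = 1 - h(0)\<close>, hence \<open>\<theta>\<^sub>4\<^sup>4 = \<theta>\<^sub>3\<^sup>4\<close>, contradicting \<open>0 < |\<theta>\<^sub>4| < \<theta>\<^sub>3\<close>.

  Poisson summation is used only in the form of its Fejer means \<open>\<integral> F(x) K\<^sub>N(x) dx\<close>, which are weighted sums
  of Fourier coefficients with weights in \<open>[0, 1]\<close>; thus no decay of the Fourier transform is needed.\<close>

section \<open>Sums of four squares\<close>

definition sum4sq :: "int \<Rightarrow> bool" where
  "sum4sq n \<longleftrightarrow> (\<exists>a b c d. n = a\<^sup>2 + b\<^sup>2 + c\<^sup>2 + d\<^sup>2)"

text \<open>The right-hand side is the norm of the quaternion \<open>x + yi + zj + wk\<close> times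
  the conjugate of \<open>a + bi + cj + dk\<close>. Because of the conjugate, if the two quaternions
  are congruent modulo \<open>m\<close> and \<open>m\<close> divides the norm, all four coordinates
  are divisible by \<open>m\<close>; the descent needs exactly this.\<close>

lemma euler_four_square:
  fixes a b c d x y z w :: "'a::comm_ring_1"
  shows "(a\<^sup>2 + b\<^sup>2 + c\<^sup>2 + d\<^sup>2) * (x\<^sup>2 + y\<^sup>2 + z\<^sup>2 + w\<^sup>2) =
    (a * x + b * y + c * z + d * w)\<^sup>2 + (a * y - b * x + c * w - d * z)\<^sup>2 +
    (a * z - c * x + d * y - b * w)\<^sup>2 + (a * w - d * x + b * z - c * y)\<^sup>2"
  by (simp add: power2_eq_square algebra_simps)

lemma sum4sq_mult: "sum4sq m \<Longrightarrow> sum4sq n \<Longrightarrow> sum4sq (m * n)"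
  unfolding sum4sq_def by (metis euler_four_square)

text \<open>An even sum of four squares has an even number of odd terms, so the terms can be paired
  with equal parity, and \<open>((a + b) / 2)\<^sup>2 + ((a - b) / 2)\<^sup>2\<close> is half of
  \<open>a\<^sup>2 + b\<^sup>2\<close>.\<close>

lemma sum4sq_halve:
  assumes "sum4sq (2 * n)"
  shows "sum4sq n"
proof -
  have *: "sum4sq n" if asm: "2 * n = a\<^sup>2 + b\<^sup>2 + c\<^sup>2 + d\<^sup>2" "even (a + b)" "even (c + d)" for a b c d
  proof -
    obtain k l where k: "a + b = 2 * k" and l: "c + d = 2 * l"
      using asm unfolding dvd_def by blast
    have bd: "b = 2 * k - a" "d = 2 * l - c" using k l by auto
    have "2 * n = 2 * (k\<^sup>2 + (a - k)\<^sup>2 + l\<^sup>2 + (c - l)\<^sup>2)"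
      unfolding asm(1) bd by (simp add: power2_eq_square algebra_simps)
    then have "n = k\<^sup>2 + (a - k)\<^sup>2 + l\<^sup>2 + (c - l)\<^sup>2" by simp
    then show ?thesis unfolding sum4sq_def by blast
  qed
  obtain a b c d where e: "2 * n = a\<^sup>2 + b\<^sup>2 + c\<^sup>2 + d\<^sup>2"
    using assms unfolding sum4sq_def by blast
  have "even (a\<^sup>2 + b\<^sup>2 + c\<^sup>2 + d\<^sup>2)" using e by (metis dvd_triv_left)
  then have "even (a + b) \<and> even (c + d) \<or> even (a + c) \<and> even (b + d) \<or> even (a + d) \<and> even (b + c)"
    by auto
  moreover have "2 * n = a\<^sup>2 + c\<^sup>2 + b\<^sup>2 + d\<^sup>2" "2 * n = a\<^sup>2 + d\<^sup>2 + b\<^sup>2 + c\<^sup>2"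
    using e by auto
  ultimately show ?thesis using * e by metis
qed

text \<open>For odd \<open>m\<close> no residue equals \<open>m / 2\<close>, so the bound is strict;
  this is what makes the descent decrease.\<close>

lemma symmetric_residue:
  fixes m x :: int
  assumes "odd m" "m > 0"
  obtains y where "m dvd x - y" "2 * \<bar>y\<bar> < m"
proof -
  define r where "r = x mod m"
  have r: "0 \<le> r" "r < m" "m dvd x - r"
    using assms by (auto simp: r_def minus_mod_eq_mult_div)
  show thesis
  proof (cases "2 * r < m")
    case True
    then show ?thesis using that r by auto
  next
    case False
    then have "2 * r \<noteq> m" using assms by auto
    moreover have "x - (r - m) = (x - r) + m" by simp
    then have "m dvd x - (r - m)" using r by (metis dvd_add dvd_refl)
    ultimately show ?thesis using that[of "r - m"] r False by auto
  qed
qed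

text \<open>Lagrange's descent. Residues \<open>x, y, z, w\<close> below \<open>m / 2\<close> in
  absolute value have a sum of squares \<open>m * r\<close> with \<open>r < m\<close>. Euler's
  identity writes \<open>(m * p) * (m * r)\<close> as four squares of multiples of \<open>m\<close>,
  and \<open>m\<^sup>2\<close> cancels.\<close>

lemma sum4sq_descent:
  fixes m p :: int
  assumes "odd m" "m > 1" "sum4sq (m * p)" "\<not> m dvd p"
  obtains r where "0 < r" "r < m" "sum4sq (r * p)"
proof -
  obtain a b c d where e: "m * p = a\<^sup>2 + b\<^sup>2 + c\<^sup>2 + d\<^sup>2"
    using assms unfolding sum4sq_def by blast
  have m0: "m > 0" using assms by simp
  obtain x where x: "m dvd a - x" "2 * \<bar>x\<bar> < m" using symmetric_residue assms(1) m0 by blast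
  obtain y where y: "m dvd b - y" "2 * \<bar>y\<bar> < m" using symmetric_residue assms(1) m0 by blast
  obtain z where z: "m dvd c - z" "2 * \<bar>z\<bar> < m" using symmetric_residue assms(1) m0 by blast
  obtain w where w: "m dvd d - w" "2 * \<bar>w\<bar> < m" using symmetric_residue assms(1) m0 by blast
  obtain i j k l where ijkl: "x = a - m * i" "y = b - m * j" "z = c - m * k" "w = d - m * l"
    using x(1) y(1) z(1) w(1) unfolding dvd_def by (metis diff_diff_eq2 add_diff_cancel_left')
  \<comment> \<open>Expanding the squares of \<open>a - m * i\<close> and its companions and
    dividing their sum by \<open>m\<close> gives this value.\<close>
  define r where "r = p + m * (i\<^sup>2 + j\<^sup>2 + k\<^sup>2 + l\<^sup>2) - 2 * (a * i + b * j + c * k + d * l)"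
  have mr: "m * r = x\<^sup>2 + y\<^sup>2 + z\<^sup>2 + w\<^sup>2"
    unfolding r_def ijkl using e by (simp add: power2_eq_square algebra_simps)
  have sq: "4 * u\<^sup>2 < m\<^sup>2" if "2 * \<bar>u\<bar> < m" for u :: int
  proof -
    have "(2 * \<bar>u\<bar>)\<^sup>2 < m\<^sup>2" using that by (intro power_strict_mono) auto
    then show ?thesis by (simp add: power_mult_distrib)
  qed
  have "4 * (m * r) < 4 * m\<^sup>2"
    unfolding mr using sq[OF x(2)] sq[OF y(2)] sq[OF z(2)] sq[OF w(2)] by simp
  then have "r < m" using m0 by (simp add: power2_eq_square)
  have "r \<ge> 0"
  proof -
    have "m * r \<ge> 0" unfolding mr by simp
    then show ?thesis using m0 by (simp add: zero_le_mult_iff)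
  qed
  \<comment> \<open>If \<open>r = 0\<close>, all residues vanish, so \<open>m\<^sup>2\<close>
    divides \<open>m * p\<close>, against \<open>\<not> m dvd p\<close>.\<close>
  have "r \<noteq> 0"
  proof
    assume "r = 0"
    then have "x = 0 \<and> y = 0 \<and> z = 0 \<and> w = 0"
      using mr by (simp add: add_nonneg_eq_0_iff)
    then have "m * p = m * (m * (i\<^sup>2 + j\<^sup>2 + k\<^sup>2 + l\<^sup>2))"
      using e ijkl by (simp add: power2_eq_square algebra_simps)
    then have "p = m * (i\<^sup>2 + j\<^sup>2 + k\<^sup>2 + l\<^sup>2)" using m0 by simp
    then show False using assms(4) by simp
  qed
  have "m\<^sup>2 * (r * p) = (a\<^sup>2 + b\<^sup>2 + c\<^sup>2 + d\<^sup>2) * (x\<^sup>2 + y\<^sup>2 + z\<^sup>2 + w\<^sup>2)"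
    unfolding e[symmetric] mr[symmetric] by (simp add: power2_eq_square algebra_simps)
  also have "\<dots> = m\<^sup>2 * ((p - (a * i + b * j + c * k + d * l))\<^sup>2 + (- a * j + b * i - c * l + d * k)\<^sup>2 +
      (- a * k + c * i - d * j + b * l)\<^sup>2 + (- a * l + d * i - b * k + c * j)\<^sup>2)"
  proof -
    \<comment> \<open>The leading part here is the full norm \<open>m * p\<close>; in the next three
      coordinates the leading parts cancel.\<close>
    have "a * x + b * y + c * z + d * w = m * (p - (a * i + b * j + c * k + d * l))"
      unfolding ijkl using e by (simp add: power2_eq_square algebra_simps)
    moreover have "a * y - b * x + c * w - d * z = m * (- a * j + b * i - c * l + d * k)"
      unfolding ijkl by (simp add: algebra_simps)
    moreover have "a * z - c * x + d * y - b * w = m * (- a * k + c * i - d * j + b * l)"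
      unfolding ijkl by (simp add: algebra_simps)
    moreover have "a * w - d * x + b * z - c * y = m * (- a * l + d * i - b * k + c * j)"
      unfolding ijkl by (simp add: algebra_simps)
    ultimately show ?thesis
      unfolding euler_four_square by (simp only: power_mult_distrib) (simp only: distrib_left)
  qed
  finally have "sum4sq (r * p)"
    using m0 unfolding sum4sq_def by auto
  moreover have "0 < r" using \<open>r \<ge> 0\<close> \<open>r \<noteq> 0\<close> by simp
  ultimately show thesis using that \<open>r < m\<close> by blast
qed

text \<open>Pigeonhole: with \<open>p = 2 * H + 1\<close>, the residues of \<open>a\<^sup>2\<close>
  and those of \<open>-1 - b\<^sup>2\<close> for arguments in \<open>0..H\<close> form two sets of
  \<open>H + 1\<close> elements, too many to be disjoint among \<open>p\<close> residues.\<close>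

lemma minus_one_sum_two_squares_mod_prime:
  fixes p :: int
  assumes "prime p" "odd p"
  obtains a b where "0 \<le> a" "2 * a < p" "0 \<le> b" "2 * b < p" "p dvd a\<^sup>2 + b\<^sup>2 + 1"
proof -
  have p: "p > 2" using assms prime_ge_2_int[of p] by (cases "p = 2") auto
  define H where "H = (p - 1) div 2"
  have H: "p = 2 * H + 1" using assms(2) by (auto simp: H_def elim: oddE)
  \<comment> \<open>A prime dividing \<open>(a - b) * (a + b)\<close> divides one factor, and both
    factors are smaller than \<open>p\<close> in absolute value.\<close>
  have inj: "a = b" if ab: "0 \<le> a" "a \<le> H" "0 \<le> b" "b \<le> H" "p dvd a\<^sup>2 - b\<^sup>2" for a b
  proof -
    have "p dvd (a - b) * (a + b)" using ab(5) by (simp add: power2_eq_square algebra_simps)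
    then have "p dvd a - b \<or> p dvd a + b" using assms(1) by (simp add: prime_dvd_mult_iff)
    then show ?thesis
    proof
      assume "p dvd a - b"
      moreover have "\<bar>a - b\<bar> < p" using ab H by linarith
      ultimately have "a - b = 0" using zdvd_not_zless[of "\<bar>a - b\<bar>" p] by force
      then show ?thesis by simp
    next
      assume "p dvd a + b"
      moreover have "a + b < p" using ab H by linarith
      ultimately have "a + b = 0" using ab zdvd_not_zless[of "a + b" p] by force
      then show ?thesis using ab by linarith
    qed
  qed
  define A where "A = (\<lambda>a. a\<^sup>2 mod p) ` {0..H}"
  define B where "B = (\<lambda>b. (- 1 - b\<^sup>2) mod p) ` {0..H}"
  have "inj_on (\<lambda>a. a\<^sup>2 mod p) {0..H}"
    using inj by (auto intro!: inj_onI simp: mod_eq_dvd_iff)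
  then have cA: "card A = nat (H + 1)" unfolding A_def by (simp add: card_image)
  have "inj_on (\<lambda>b. (- 1 - b\<^sup>2) mod p) {0..H}"
    using inj by (auto intro!: inj_onI simp: mod_eq_dvd_iff dvd_diff_commute)
  then have cB: "card B = nat (H + 1)" unfolding B_def by (simp add: card_image)
  have sub: "A \<union> B \<subseteq> {0..<p}" unfolding A_def B_def using p by auto
  have "A \<inter> B \<noteq> {}"
  proof
    assume "A \<inter> B = {}"
    then have "card (A \<union> B) = card A + card B"
      by (intro card_Un_disjoint) (auto simp: A_def B_def)
    moreover have "card (A \<union> B) \<le> card {0..<p}" using sub by (intro card_mono) auto
    ultimately show False using cA cB H p by simp
  qed
  then obtain a b where ab: "a \<in> {0..H}" "b \<in> {0..H}" "a\<^sup>2 mod p = (- 1 - b\<^sup>2) mod p"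
    unfolding A_def B_def by (auto simp del: atLeastAtMost_iff)
  then have "p dvd a\<^sup>2 - (- 1 - b\<^sup>2)" by (simp only: mod_eq_dvd_iff)
  then have "p dvd a\<^sup>2 + b\<^sup>2 + 1" by (simp add: algebra_simps)
  then show thesis using that[of a b] ab H by auto
qed

text \<open>The pigeonhole argument supplies a sum of four squares of the form \<open>m * p\<close>
  with \<open>0 < m < p\<close>. Halving for even \<open>m\<close> and descent for odd
  \<open>m > 1\<close> lower \<open>m\<close> until it is 1.\<close>

lemma sum4sq_prime:
  fixes p :: int
  assumes "prime p"
  shows "sum4sq p"
proof (cases "odd p")
  case False
  then have "p = 2" using assms primes_dvd_imp_eq[of 2 p] by simp
  moreover have "(2::int) = 1\<^sup>2 + 1\<^sup>2 + 0\<^sup>2 + 0\<^sup>2" by simp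
  ultimately show ?thesis unfolding sum4sq_def by metis
next
  case True
  have p: "p > 1" using assms prime_gt_1_int by blast
  have main: "sum4sq (int m * p) \<Longrightarrow> 0 < m \<Longrightarrow> int m < p \<Longrightarrow> sum4sq p" for m
  proof (induction m rule: less_induct)
    case (less m)
    consider "m = 1" | "even m" | "odd m" "m > 1" using less.prems by force
    then show ?case
    proof cases
      case 1
      then show ?thesis using less.prems by simp
    next
      case 2
      then obtain k where k: "m = 2 * k" by blast
      then have "sum4sq (2 * (int k * p))" using less.prems by (simp add: mult.assoc)
      then have "sum4sq (int k * p)" by (rule sum4sq_halve)
      then show ?thesis using less.IH[of k] less.prems k by auto
    next
      case 3
      have "\<not> int m dvd p"
        using 3 less.prems assms by (metis nat_neq_iff of_nat_1 of_nat_less_iff prime_int_iff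
            of_nat_0_le_iff order_less_irrefl)
      then obtain r where r: "0 < r" "r < int m" "sum4sq (r * p)"
        using sum4sq_descent[of "int m" p] 3 less.prems by auto
      then show ?thesis using less.IH[of "nat r"] less.prems by auto
    qed
  qed
  obtain a b where ab: "0 \<le> a" "2 * a < p" "0 \<le> b" "2 * b < p" "p dvd a\<^sup>2 + b\<^sup>2 + 1"
    using minus_one_sum_two_squares_mod_prime[OF assms True] by blast
  then obtain m where m: "a\<^sup>2 + b\<^sup>2 + 1 = p * m" by (meson dvdE)
  have "a\<^sup>2 + b\<^sup>2 + 1 > 0" by (simp add: add_nonneg_pos)
  then have "m > 0" using m p by (simp add: zero_less_mult_iff)
  have sq: "4 * u\<^sup>2 < p\<^sup>2" if "0 \<le> u" "2 * u < p" for u :: int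
  proof -
    have "(2 * u)\<^sup>2 < p\<^sup>2" using that by (intro power_strict_mono) auto
    then show ?thesis by (simp add: power_mult_distrib)
  qed
  \<comment> \<open>\<open>4 * (a\<^sup>2 + b\<^sup>2 + 1) < 2 * p\<^sup>2 + 4 \<le> 3 *
    p\<^sup>2\<close>, so the multiplier \<open>m\<close> is below \<open>p\<close>.\<close>
  have "p * 1 < p * p" using p by simp
  moreover have "p\<^sup>2 \<ge> 4" using p power_mono[of 2 p 2] by simp
  ultimately have "p * m < p * p"
    using sq[OF ab(1,2)] sq[OF ab(3,4)] m by (simp add: power2_eq_square)
  then have "m < p" using p by simp
  have "m * p = a\<^sup>2 + b\<^sup>2 + 1\<^sup>2 + 0\<^sup>2" using m by (simp add: mult.commute)
  then have "sum4sq (m * p)" unfolding sum4sq_def by blast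
  then show ?thesis using main[of "nat m"] \<open>m > 0\<close> \<open>m < p\<close> by simp
qed

theorem four_squares: "sum4sq (int n)"
proof (induction n rule: prime_divisors_induct)
  case zero
  have "(0::int) = 0\<^sup>2 + 0\<^sup>2 + 0\<^sup>2 + 0\<^sup>2" by simp
  then show ?case unfolding sum4sq_def by (metis of_nat_0)
next
  case (unit x)
  have "(1::int) = 1\<^sup>2 + 0\<^sup>2 + 0\<^sup>2 + 0\<^sup>2" by simp
  then show ?case using unit unfolding sum4sq_def by (metis nat_dvd_1_iff_1 of_nat_1)
next
  case (factor p x)
  then show ?case using sum4sq_mult sum4sq_prime by simp
qed

section \<open>The Fejer kernel on the cube\<close>

text \<open>In period 1, the frequency \<open>k\<close> with \<open>\<bar>k\<bar> < N\<close>
  carries weight \<open>1 - \<bar>k\<bar> / N\<close>. The squared form shows nonnegativity; for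
  \<open>N = 0\<close> the value is 0.\<close>

definition fejer :: "nat \<Rightarrow> real \<Rightarrow> real" where
  "fejer N x = (norm (\<Sum>j<N. cis (2 * pi * real j * x)))\<^sup>2 / N"

lemma fejer_nonneg: "fejer N x \<ge> 0"
  by (simp add: fejer_def)

lemma continuous_on_fejer: "continuous_on A (fejer N)"
  unfolding fejer_def 
  by (cases "N = 0") (auto intro!: continuous_intros)

lemma fejer_measurable [measurable]: "fejer N \<in> borel_measurable borel"
  by (intro borel_measurable_continuous_onI continuous_on_fejer)

lemma fejer_plus_of_int: "fejer N (of_int m + x) = fejer N x"
proof -
  have "cis (2 * pi * real j * (of_int m + x)) = cis (2 * pi * real j * x)" for j
  proof -
    have "2 * pi * real j * (of_int m + x) = 2 * pi * real j * x + 2 * pi * of_int (int j * m)"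
      by (simp add: algebra_simps)
    also have "cis \<dots> = cis (2 * pi * real j * x) * cis (2 * pi * of_int (int j * m))"
      by (simp only: cis_mult)
    also have "cis (2 * pi * of_int (int j * m)) = 1"
      by (rule cis_multiple_2pi) auto
    finally show ?thesis by simp
  qed
  then show ?thesis by (simp add: fejer_def)
qed

text \<open>The exponentials form a geometric sum with ratio \<open>z\<close>, so its norm times
  \<open>norm (1 - z)\<close> is \<open>norm (1 - z ^ N) \<le> 2\<close>, while
  \<open>norm (1 - z)\<close> is twice \<open>\<bar>sin (pi * x)\<bar>\<close>.\<close>

lemma sin_squared_fejer_le: "(sin (pi * x))\<^sup>2 * fejer N x \<le> 1 / N"
proof -
  define z where "z = cis (2 * pi * x)"
  have norm_diff: "norm (1 - cis y) = 2 * \<bar>sin (y / 2)\<bar>" for y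
  proof -
    have "(norm (1 - cis y))\<^sup>2 = (1 - cos y)\<^sup>2 + (sin y)\<^sup>2"
      by (simp add: cmod_power2)
    also have "\<dots> = 2 - 2 * cos y"
      using sin_cos_squared_add[of y] by (simp add: power2_eq_square algebra_simps)
    also have "\<dots> = (2 * \<bar>sin (y / 2)\<bar>)\<^sup>2"
      using cos_double_sin[of "y / 2"] by (simp add: power_mult_distrib)
    finally show ?thesis by (metis abs_ge_zero mult_nonneg_nonneg norm_ge_zero power2_eq_imp_eq zero_le_numeral)
  qed
  have "(\<Sum>j<N. cis (2 * pi * real j * x)) = (\<Sum>j<N. z ^ j)"
    by (intro sum.cong refl) (simp only: z_def Complex.DeMoivre mult_ac)
  then have "(1 - z) * (\<Sum>j<N. cis (2 * pi * real j * x)) = 1 - z ^ N"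
    by (simp add: one_diff_power_eq)
  then have "norm (1 - z) * norm (\<Sum>j<N. cis (2 * pi * real j * x)) \<le> 2"
    using norm_diff[of "real N * (2 * pi * x)"] 
    by (metis Complex.DeMoivre abs_sin_le_one mult_2 mult_left_le norm_mult z_def zero_le_numeral)
  then have "\<bar>sin (pi * x)\<bar> * norm (\<Sum>j<N. cis (2 * pi * real j * x)) \<le> 1"
    by (simp add: z_def norm_diff)
  then have "(\<bar>sin (pi * x)\<bar> * norm (\<Sum>j<N. cis (2 * pi * real j * x)))\<^sup>2 \<le> 1"
    by (intro power_le_one) auto
  then show ?thesis
    by (simp add: fejer_def power_mult_distrib divide_right_mono)
qed

text \<open>Jordan's inequality: by concavity the sine lies above its chord from 0 to
  \<open>pi / 2\<close>.\<close>

lemma abs_sin_ge: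
  assumes "\<bar>x\<bar> \<le> 1 / 2"
  shows "2 * \<bar>x\<bar> \<le> \<bar>sin (pi * x)\<bar>"
proof -
  have "2 * y \<le> sin (pi * y)" if y: "0 \<le> y" "y \<le> 1 / 2" for y :: real
  proof -
    have "concave_on {0..pi} sin"
      by (rule f''_le0_imp_concave[where f' = cos and f'' = "\<lambda>x. - sin x"])
        (auto intro!: derivative_eq_intros sin_ge_zero)
    then have "sin ((1 - 2 * y) *\<^sub>R 0 + (2 * y) *\<^sub>R (pi / 2)) \<ge> (1 - 2 * y) * sin 0 + (2 * y) * sin (pi / 2)"
      using y by (intro concave_onD) auto
    then show ?thesis by (simp add: mult.commute)
  qed
  from this[of "\<bar>x\<bar>"] assms show ?thesis
    by (cases "x \<ge> 0") auto
qed

text \<open>This uniform bound controls second moments, and through them the concentration of the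
  kernel at 0.\<close>

lemma square_fejer_le:
  assumes "\<bar>x\<bar> \<le> 1 / 2"
  shows "x\<^sup>2 * fejer N x \<le> 1 / (4 * real N)"
proof -
  have "(2 * \<bar>x\<bar>)\<^sup>2 \<le> \<bar>sin (pi * x)\<bar>\<^sup>2"
    using abs_sin_ge[OF assms] by (intro power_mono) auto
  then have "4 * x\<^sup>2 * fejer N x \<le> (sin (pi * x))\<^sup>2 * fejer N x"
    by (intro mult_right_mono fejer_nonneg) (simp add: power_mult_distrib)
  then show ?thesis using sin_squared_fejer_le[of x N] by simp
qed

lemma fejer_eq_sum:
  "fejer N x = (\<Sum>j<N. \<Sum>l<N. cos (2 * pi * (real j - real l) * x)) / N"
proof -
  have "complex_of_real ((norm (\<Sum>j<N. cis (2 * pi * real j * x)))\<^sup>2) =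
      (\<Sum>j<N. \<Sum>l<N. cis (2 * pi * (real j - real l) * x))"
    unfolding complex_norm_square 
    by (simp add: cis_cnj sum_product cis_mult algebra_simps)
  then have "(norm (\<Sum>j<N. cis (2 * pi * real j * x)))\<^sup>2 = Re \<dots>"
    by (metis Re_complex_of_real)
  then show ?thesis by (simp add: fejer_def)
qed

lemma has_integral_cos_int:
  "((\<lambda>x. cos (2 * pi * of_int m * x)) has_integral (if m = 0 then 1 else 0)) {-1/2..1/2}"
proof (cases "m = 0")
  case True
  then show ?thesis using has_integral_const_real[of "1::real" "-1/2" "1/2"] by simp
next
  case False
  have "((\<lambda>x. cos (2 * pi * of_int m * x)) has_integral
      sin (2 * pi * of_int m * (1/2)) / (2 * pi * of_int m) - sin (2 * pi * of_int m * (-1/2)) / (2 * pi * of_int m)) {-1/2..1/2}"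
    using False
    by (intro fundamental_theorem_of_calculus)
      (auto intro!: derivative_eq_intros simp flip: has_real_derivative_iff_has_vector_derivative)
  moreover have "sin (pi * of_int m) = 0" by (simp add: sin_zero_iff_int2)
  ultimately show ?thesis using False by (simp add: mult.assoc)
qed

text \<open>By orthogonality only the \<open>N\<close> diagonal pairs \<open>j = l\<close>
  contribute, which the factor \<open>1 / N\<close> normalises.\<close>

lemma has_integral_fejer:
  assumes "N > 0"
  shows "(fejer N has_integral 1) {-1/2..1/2}"
proof -
  have "((\<lambda>x. (\<Sum>j<N. \<Sum>l<N. cos (2 * pi * of_int (int j - int l) * x)) / N) has_integral
      (\<Sum>j<N. \<Sum>l<N. if int j - int l = 0 then 1 else 0) / real N) {-1/2..1/2}"
    by (intro has_integral_divide has_integral_sum has_integral_cos_int) auto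
  moreover have "(\<Sum>j<N. \<Sum>l<N. if int j - int l = 0 then 1 else 0) = real N" by simp
  ultimately show ?thesis using assms by (simp add: fejer_eq_sum[abs_def])
qed

lemma nn_integral_fejer:
  assumes "N > 0"
  shows "(\<integral>\<^sup>+x. ennreal (indicator {-1/2..<1/2} x * fejer N x) \<partial>lborel) = 1"
proof -
  have "(\<integral>\<^sup>+x. ennreal (indicator {-1/2..<1/2} x * fejer N x) \<partial>lborel) = (\<integral>\<^sup>+x. ennreal (fejer N x) * indicator {-1/2..1/2} x \<partial>lborel)"
    by (intro nn_integral_cong_AE AE_I[where N = "{1/2}"]) (auto simp: indicator_def)
  also have "\<dots> = ennreal 1"
   using nn_integral_has_integral_lebesgue'[OF fejer_nonneg has_integral_fejer[OF assms]] .
  finally show ?thesis by simp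
qed

section \<open>Integer translates of the unit cube\<close>

lemma nn_integral_lborel_vec_prod:
  fixes f :: "'n::finite \<Rightarrow> real \<Rightarrow> ennreal"
  assumes [measurable]: "\<And>i. f i \<in> borel_measurable borel"
  shows "(\<integral>\<^sup>+x. (\<Prod>i\<in>UNIV. f i (vec_nth x i)) \<partial>(lborel :: (real ^ 'n) measure)) =
    (\<Prod>i\<in>UNIV. (\<integral>\<^sup>+x. f i x \<partial>lborel))"
proof -
  have B: "(Basis :: (real ^ 'n) set) = range (\<lambda>i. axis i 1)"
    by (auto simp: Basis_vec_def)
  have inj: "inj (\<lambda>i::'n. axis i (1::real))"
    by (auto intro!: injI simp: axis_eq_axis)
  define g where "g = (\<lambda>b::real^'n. f (inv_into UNIV (\<lambda>i. axis i 1) b))"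
  have g: "g (axis i 1) = f i" for i
    unfolding g_def by (simp add: inv_f_f[OF inj])
  have "(\<integral>\<^sup>+x. (\<Prod>b\<in>Basis. g b (inner x b)) \<partial>(lborel :: (real ^ 'n) measure)) =
      (\<Prod>b\<in>Basis. (\<integral>\<^sup>+x. g b x \<partial>lborel))"
    by (rule nn_integral_lborel_prod) (auto simp: g_def)
  then show ?thesis
    unfolding B prod.reindex[OF inj] by (simp add: g inner_axis)
qed

definition int_vec :: "('n \<Rightarrow> int) \<Rightarrow> real ^ 'n" where
  "int_vec m = (\<chi> i. of_int (m i))"

lemma int_vec_nth [simp]: "vec_nth (int_vec m) i = of_int (m i)"
  by (simp add: int_vec_def)

lemma inj_int_vec: "inj int_vec"
  by (auto intro!: injI simp: int_vec_def Finite_Cartesian_Product.vec_eq_iff)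

lemma int_vec_zero [simp]: "int_vec (\<lambda>_. 0) = 0"
  by (simp add: int_vec_def Finite_Cartesian_Product.zero_vec_def)

lemma int_vec_eq_0_iff: "int_vec k = 0 \<longleftrightarrow> k = (\<lambda>_. 0)"
  using inj_int_vec by (metis injD int_vec_zero)

text \<open>Half-open, so that the integer translates partition the space exactly.\<close>

definition half_cube :: "(real ^ 'n) set" where
  "half_cube = {x. \<forall>i. - 1 / 2 \<le> vec_nth x i \<and> vec_nth x i < 1 / 2}"

lemma half_cube_measurable [measurable]: "half_cube \<in> sets (borel :: (real ^ 'n::finite) measure)"
proof -
  have "half_cube = (\<Inter>i. {x::real ^ 'n. - 1 / 2 \<le> vec_nth x i} \<inter> {x. vec_nth x i < 1 / 2})"
    by (auto simp: half_cube_def)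
  also have "\<dots> \<in> sets borel"
    by (intro sets.countable_INT'' sets.Int borel_closed borel_open closed_Collect_le open_Collect_less continuous_intros) auto
  finally show ?thesis .
qed

lemma indicator_half_cube:
  "indicator half_cube x = (\<Prod>i\<in>UNIV. indicator {-1/2..<1/2} (vec_nth x i) :: real)"
proof (cases "x \<in> half_cube")
  case True
  then show ?thesis by (auto simp: half_cube_def indicator_def intro!: prod.neutral[symmetric])
next
  case False
  then obtain i where "\<not> (- 1 / 2 \<le> vec_nth x i \<and> vec_nth x i < 1 / 2)"
    unfolding half_cube_def by auto
  then have "(\<Prod>i\<in>UNIV. indicator {-1/2..<1/2} (vec_nth x i) :: real) = 0"
    by (intro prod_zero bexI[of _ i]) auto
  then show ?thesis using False by simp
qed

lemma half_cube_translates: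
  "x - int_vec m \<in> half_cube \<longleftrightarrow> m = (\<lambda>i. \<lfloor>vec_nth x i + 1 / 2\<rfloor>)"
proof -
  have "- 1 / 2 \<le> vec_nth x i - of_int (m i) \<and> vec_nth x i - of_int (m i) < 1 / 2 \<longleftrightarrow> m i = \<lfloor>vec_nth x i + 1 / 2\<rfloor>" for i
    by linarith
  then show ?thesis by (auto simp: half_cube_def fun_eq_iff)
qed

lemma lborel_integral_translate:
  fixes f :: "'a::euclidean_space \<Rightarrow> 'b::{banach, second_countable_topology}"
  assumes [measurable]: "f \<in> borel_measurable borel"
  shows "(LINT x|lborel. f (c + x)) = (LINT x|lborel. f x)"
proof -
  have "(LINT x|lborel. f x) = (LINT x|distr lborel borel ((+) c). f x)"
    by (simp add: lborel_distr_plus)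
  also have "\<dots> = (LINT x|lborel. f (c + x))"
    by (subst integral_distr) auto
  finally show ?thesis by simp
qed

lemma has_bochner_integral_count_space_delta:
  fixes v :: "'b::{banach,second_countable_topology}"
  shows "has_bochner_integral (count_space UNIV) (\<lambda>m. if m = a then v else 0) v"
proof -
  have "has_bochner_integral (count_space UNIV) (\<lambda>m. indicator {a} m *\<^sub>R v) (measure (count_space UNIV) {a} *\<^sub>R v)"
    by (intro has_bochner_integral_scaleR_left has_bochner_integral_real_indicator) auto
  moreover have "(\<lambda>m. indicator {a} m *\<^sub>R v) = (\<lambda>m. if m = a then v else 0)"
    by (auto simp: indicator_def)
  ultimately show ?thesis by (simp add: measure_count_space)
qed

text \<open>Fubini for Lebesgue measure times counting measure on the integer vectors: each point
  lies in exactly one translate of the cube, so the inner sum has the single term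
  \<open>G x\<close>.\<close>

lemma integral_eq_sum_over_cubes:
  fixes G :: "real ^ 'n::finite \<Rightarrow> complex"
  assumes G: "integrable lborel G"
  shows "(LINT x|lborel. G x) =
    (LINT m|count_space UNIV. LINT x|lborel. indicator half_cube x *\<^sub>R G (int_vec m + x))"
proof -
  have [measurable]: "G \<in> borel_measurable borel" using borel_measurable_integrable[OF G] by simp
  interpret C: sigma_finite_measure "count_space (UNIV :: ('n \<Rightarrow> int) set)"
    by (rule sigma_finite_measure_count_space_countable) simp
  interpret P: pair_sigma_finite "lborel :: (real ^ 'n) measure" "count_space (UNIV :: ('n \<Rightarrow> int) set)" ..
  define f where "f = (\<lambda>x m. indicator half_cube (x - int_vec m) *\<^sub>R G x)"
  have meas: "(\<lambda>(x, m). f x m) \<in> borel_measurable (lborel \<Otimes>\<^sub>M count_space UNIV)"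
  proof -
    have "(\<lambda>(m, x). f x m) \<in> borel_measurable (count_space UNIV \<Otimes>\<^sub>M lborel)"
      by (rule measurable_pair_measure_countable1) (auto simp: f_def)
    from measurable_pair_swap[OF this] show ?thesis by (simp add: case_prod_beta)
  qed
  \<comment> \<open>\<open>M x\<close> is the centre of the translate containing
    \<open>x\<close>.\<close>
  define M where "M = (\<lambda>x :: real ^ 'n. (\<lambda>i. \<lfloor>vec_nth x i + 1 / 2\<rfloor>))"
  have f: "f x m = (if m = M x then G x else 0)" for x m
    using half_cube_translates[of x m] by (auto simp: f_def M_def)
  have int: "integrable (lborel \<Otimes>\<^sub>M count_space UNIV) (\<lambda>(x, m). f x m)"
  proof (rule P.Fubini_integrable)
    have "(LINT m|count_space UNIV. norm (f x m)) = norm (G x)" for x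
      using has_bochner_integral_integral_eq[OF has_bochner_integral_count_space_delta[of "M x" "norm (G x)"]] by (simp add: f if_distrib[of norm] cong: if_cong)
    then show "integrable lborel (\<lambda>x. LINT m|count_space UNIV. norm (case (x, m) of (x, m) \<Rightarrow> f x m))"
      using G by simp
    show "AE x in lborel. integrable (count_space UNIV) (\<lambda>m. case (x, m) of (x, m) \<Rightarrow> f x m)"
      by (auto simp: f intro!: integrable.intros has_bochner_integral_count_space_delta)
  qed (use meas in simp)
  have "(LINT x|lborel. G x) = (LINT x|lborel. LINT m|count_space UNIV. f x m)"
    by (simp add: f has_bochner_integral_integral_eq[OF has_bochner_integral_count_space_delta])
  also have "\<dots> = (LINT m|count_space UNIV. LINT x|lborel. f x m)"
    by (rule P.Fubini_integral[OF int, symmetric])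
  also have "\<dots> = (LINT m|count_space UNIV. LINT x|lborel. indicator half_cube x *\<^sub>R G (int_vec m + x))"
  proof (rule Bochner_Integration.integral_cong[OF refl])
    fix m
    show "(LINT x|lborel. f x m) = (LINT x|lborel. indicator half_cube x *\<^sub>R G (int_vec m + x))"
      by (subst lborel_integral_translate[where c = "int_vec m", symmetric]) (auto simp: f_def)
  qed
  finally show ?thesis .
qed

section \<open>The product kernel as an approximate identity\<close>

definition fejer_vec :: "nat \<Rightarrow> real ^ 'n::finite \<Rightarrow> real" where
  "fejer_vec N x = (\<Prod>i\<in>UNIV. fejer N (vec_nth x i))"

lemma fejer_vec_nonneg: "fejer_vec N x \<ge> 0"
  unfolding fejer_vec_def by (intro prod_nonneg ballI fejer_nonneg)

lemma borel_measurable_vec_nth_compose [measurable (raw)]: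
  assumes [measurable]: "f \<in> borel_measurable M"
  shows "(\<lambda>x. vec_nth (f x :: real ^ 'n::finite) i) \<in> borel_measurable M"
proof -
  have "(\<lambda>x::real^'n. vec_nth x i) \<in> borel_measurable borel"
    by (intro borel_measurable_continuous_onI continuous_intros)
  from measurable_compose[OF assms this] show ?thesis .
qed

lemma fejer_vec_measurable [measurable]: "fejer_vec N \<in> borel_measurable borel"
  unfolding fejer_vec_def by measurable

lemma fejer_vec_plus_int_vec: "fejer_vec N (int_vec m + x) = fejer_vec N x"
  by (simp add: fejer_vec_def fejer_plus_of_int)

lemma nn_integral_fejer_vec:
  assumes "N > 0"
  shows "(\<integral>\<^sup>+x. ennreal (indicator half_cube x * fejer_vec N x) \<partial>(lborel :: (real ^ 'n::finite) measure)) = 1"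
proof -
  have "(\<integral>\<^sup>+x. ennreal (indicator half_cube x * fejer_vec N x) \<partial>(lborel :: (real ^ 'n) measure)) =
      (\<integral>\<^sup>+x. (\<Prod>i\<in>UNIV. ennreal (indicator {-1/2..<1/2} (vec_nth x i) * fejer N (vec_nth x i))) \<partial>(lborel :: (real ^ 'n) measure))"
    by (intro nn_integral_cong, subst prod_ennreal)
      (auto simp: indicator_half_cube fejer_vec_def prod.distrib fejer_nonneg)
  also have "\<dots> = 1"
    by (subst nn_integral_lborel_vec_prod) (simp_all only: nn_integral_fejer[OF assms] prod.neutral_const, measurable)
  finally show ?thesis .
qed

text \<open>The square is a weight in coordinate \<open>k\<close> alone, so the other factors
  integrate to 1 and the pointwise bound on an interval of length 1 remains.\<close>

lemma nn_integral_square_fejer_vec_le: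
  assumes "N > 0"
  shows "(\<integral>\<^sup>+x. ennreal (indicator half_cube x * fejer_vec N x * (vec_nth x k)\<^sup>2) \<partial>(lborel :: (real ^ 'n::finite) measure)) \<le> ennreal (1 / (4 * real N))"
proof -
  define w where "w = (\<lambda>i x. if i = k then x\<^sup>2 else 1 :: real)"
  have [measurable]: "w i \<in> borel_measurable borel" for i unfolding w_def by (cases "i = k") auto
  have w0: "w i x \<ge> 0" for i x by (simp add: w_def)
  have wprod: "(\<Prod>i\<in>UNIV. w i (vec_nth x i)) = (vec_nth x k)\<^sup>2" for x :: "real ^ 'n"
    unfolding w_def by (simp add: prod.delta)
  have "(\<integral>\<^sup>+x. ennreal (indicator half_cube x * fejer_vec N x * (vec_nth x k)\<^sup>2) \<partial>(lborel :: (real ^ 'n) measure)) =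
      (\<integral>\<^sup>+x. (\<Prod>i\<in>UNIV. ennreal (indicator {-1/2..<1/2} (vec_nth x i) * fejer N (vec_nth x i) * w i (vec_nth x i))) \<partial>(lborel :: (real ^ 'n) measure))"
    by (intro nn_integral_cong, subst prod_ennreal)
      (auto simp: indicator_half_cube fejer_vec_def prod.distrib fejer_nonneg w0 wprod)
  also have "\<dots> = (\<Prod>i\<in>UNIV. \<integral>\<^sup>+x. ennreal (indicator {-1/2..<1/2} x * fejer N x * w i x) \<partial>lborel)"
    by (subst nn_integral_lborel_vec_prod) (simp_all, measurable)
  also have "\<dots> = (\<integral>\<^sup>+x. ennreal (indicator {-1/2..<1/2} x * fejer N x * x\<^sup>2) \<partial>lborel)"
  proof -
    have "(\<integral>\<^sup>+x. ennreal (indicator {-1/2..<1/2} x * fejer N x * w i x) \<partial>lborel) =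
      (if i = k then (\<integral>\<^sup>+x. ennreal (indicator {-1/2..<1/2} x * fejer N x * x\<^sup>2) \<partial>lborel) else 1)" for i
      using nn_integral_fejer[OF assms] by (simp add: w_def)
    then show ?thesis by (simp add: prod.delta)
  qed
  also have "\<dots> \<le> (\<integral>\<^sup>+x. ennreal (1 / (4 * real N)) * indicator {-1/2..<1/2::real} x \<partial>lborel)"
  proof (intro nn_integral_mono)
    fix x :: real
    show "ennreal (indicator {-1/2..<1/2} x * fejer N x * x\<^sup>2) \<le> ennreal (1 / (4 * real N)) * indicator {-1/2..<1/2::real} x"
      using square_fejer_le[of x N] by (auto simp: indicator_def mult.commute intro!: ennreal_leI)
  qed
  also have "\<dots> = ennreal (1 / (4 * real N))"
    by (subst nn_integral_cmult_indicator) auto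
  finally show ?thesis .
qed

text \<open>Chebyshev's argument: the deviation of \<open>g\<close> from \<open>g 0\<close> is at
  most \<open>e / 2\<close> plus a multiple of the squared norm, so unit mass and small second
  moments bound its mean. \<open>Suc N\<close> avoids the zero kernel.\<close>

lemma fejer_vec_approximate_identity:
  fixes g :: "real ^ 'n::finite \<Rightarrow> complex"
  assumes [measurable]: "g \<in> borel_measurable borel"
    and cont: "isCont g 0" and B: "\<And>x. norm (g x) \<le> B"
  shows "(\<lambda>N. LINT x|lborel. indicator half_cube x *\<^sub>R (g x * of_real (fejer_vec (Suc N) x))) \<longlonglongrightarrow> g 0"
proof (rule LIMSEQ_I)
  fix e :: real assume e: "e > 0"
  have B0: "B \<ge> 0" using B[of 0] norm_ge_zero order_trans by blast
  obtain d where d: "d > 0" "\<And>x. norm x < d \<Longrightarrow> norm (g x - g 0) < e / 2"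
    using cont e unfolding continuous_at_eps_delta dist_norm
    by (metis diff_zero half_gt_zero)
  \<comment> \<open>Chosen so that \<open>C * (norm x)\<^sup>2\<close> is at least the trivial bound
    \<open>2 * B\<close> once \<open>norm x \<ge> d\<close>.\<close>
  define C where "C = 2 * B / d\<^sup>2"
  have C0: "C \<ge> 0" using B0 d by (simp add: C_def)
  define n where "n = CARD('n)"
  have near: "norm (g x - g 0) \<le> e / 2 + C * (\<Sum>i\<in>UNIV. (vec_nth x i)\<^sup>2)" for x
  proof (cases "norm x < d")
    case True
    have "0 \<le> C * (\<Sum>i\<in>UNIV. (vec_nth x i)\<^sup>2)" using C0 by (intro mult_nonneg_nonneg sum_nonneg) auto
    then show ?thesis using d(2)[OF True] by simp
  next
    case False
    have "norm (g x - g 0) \<le> 2 * B"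
      using norm_triangle_ineq4[of "g x" "g 0"] B[of x] B[of 0] by simp
    also have "\<dots> = C * d\<^sup>2" using d by (simp add: C_def)
    also have "\<dots> \<le> C * (norm x)\<^sup>2" using False d C0 by (intro mult_left_mono power_mono) auto
    also have "(norm x)\<^sup>2 = (\<Sum>i\<in>UNIV. (vec_nth x i)\<^sup>2)"
      by (simp add: norm_vec_def L2_set_def sum_nonneg)
    finally show ?thesis using e by simp
  qed
  \<comment> \<open>Beyond \<open>N0\<close> the second-moment contribution,
    \<open>C * n / 4\<close> divided by \<open>Suc N\<close>, is below \<open>e / 2\<close>.\<close>
  obtain N0 :: nat where N0: "C * n / 4 / (e / 2) < N0" using reals_Archimedean2 by blast
  show "\<exists>N0. \<forall>N\<ge>N0. norm ((LINT x|lborel. indicator half_cube x *\<^sub>R (g x * of_real (fejer_vec (Suc N) x))) - g 0) < e"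
  proof (intro exI[of _ N0] allI impI)
    fix N assume "N \<ge> N0"
    define K where "K = (\<lambda>x :: real ^ 'n. indicator half_cube x * fejer_vec (Suc N) x)"
    have K0: "K x \<ge> 0" for x by (simp add: K_def fejer_vec_nonneg)
    have [measurable]: "K \<in> borel_measurable borel" unfolding K_def by measurable
    have Kint: "has_bochner_integral lborel K 1"
    proof (rule has_bochner_integral_nn_integral)
      show "(\<integral>\<^sup>+x. ennreal (K x) \<partial>lborel) = ennreal 1"
        using nn_integral_fejer_vec[of "Suc N", where 'n = 'n] by (simp add: K_def)
    qed (auto simp: K0)
    have K2le: "(\<integral>\<^sup>+x. ennreal (K x * (vec_nth x i)\<^sup>2) \<partial>lborel) \<le> ennreal (1 / (4 * real (Suc N)))" for i
      using nn_integral_square_fejer_vec_le[of "Suc N" i] by (simp add: K_def)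
    have K2int: "integrable lborel (\<lambda>x. K x * (vec_nth x i)\<^sup>2)" for i
    proof (rule integrableI_bounded)
      show "(\<integral>\<^sup>+x. ennreal (norm (K x * (vec_nth x i)\<^sup>2)) \<partial>lborel) < \<infinity>"
        using K2le[of i] K0 by (auto simp: le_less_trans[OF _ ennreal_less_top] abs_mult)
    qed measurable
    have K2: "(LINT x|lborel. K x * (vec_nth x i)\<^sup>2) \<le> 1 / (4 * real (Suc N))" for i
    proof -
      have "ennreal (LINT x|lborel. K x * (vec_nth x i)\<^sup>2) \<le> ennreal (1 / (4 * real (Suc N)))"
        using K2le[of i] nn_integral_eq_integral[OF K2int[of i]] K0 by simp
      then show ?thesis by (subst (asm) ennreal_le_iff) auto
    qed
    have Kg: "integrable lborel (\<lambda>x. K x *\<^sub>R g x)"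
    proof (rule Bochner_Integration.integrable_bound)
      show "integrable lborel (\<lambda>x. B * K x)" using Kint by (simp add: has_bochner_integral_iff)
      show "AE x in lborel. norm (K x *\<^sub>R g x) \<le> norm (B * K x)"
      proof (intro AE_I2)
        fix x show "norm (K x *\<^sub>R g x) \<le> norm (B * K x)"
          using mult_left_mono[OF B[of x] K0[of x]] K0[of x] B0 by (simp add: abs_mult mult.commute)
      qed
    qed measurable
    have Kg0: "has_bochner_integral lborel (\<lambda>x. K x *\<^sub>R g 0) (1 *\<^sub>R g 0)"
      by (intro has_bochner_integral_scaleR_left Kint)
    have "(LINT x|lborel. indicator half_cube x *\<^sub>R (g x * of_real (fejer_vec (Suc N) x))) - g 0 =
        (LINT x|lborel. K x *\<^sub>R g x) - (LINT x|lborel. K x *\<^sub>R g 0)"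
      using has_bochner_integral_integral_eq[OF Kg0]
      by (simp add: K_def scaleR_conv_of_real mult_ac)
    also have "\<dots> = (LINT x|lborel. K x *\<^sub>R (g x - g 0))"
      using Kg Kg0 by (simp add: has_bochner_integral_iff scaleR_diff_right)
    finally have "norm ((LINT x|lborel. indicator half_cube x *\<^sub>R (g x * of_real (fejer_vec (Suc N) x))) - g 0)
       = norm (LINT x|lborel. K x *\<^sub>R (g x - g 0))" by simp
    also have "\<dots> \<le> (LINT x|lborel. norm (K x *\<^sub>R (g x - g 0)))" by (rule integral_norm_bound)
    also have "\<dots> \<le> (LINT x|lborel. (e / 2) * K x + C * (\<Sum>i\<in>UNIV. K x * (vec_nth x i)\<^sup>2))"
    proof (rule integral_mono)
      have "integrable lborel (\<lambda>x. K x *\<^sub>R (g x - g 0))"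
        using Kg Kg0 by (simp add: has_bochner_integral_iff scaleR_diff_right)
      then show "integrable lborel (\<lambda>x. norm (K x *\<^sub>R (g x - g 0)))" by (rule integrable_norm)
      show "integrable lborel (\<lambda>x. (e / 2) * K x + C * (\<Sum>i\<in>UNIV. K x * (vec_nth x i)\<^sup>2))"
        using Kint K2int by (auto simp: has_bochner_integral_iff)
      show "norm (K x *\<^sub>R (g x - g 0)) \<le> (e / 2) * K x + C * (\<Sum>i\<in>UNIV. K x * (vec_nth x i)\<^sup>2)" for x
        unfolding norm_scaleR using mult_left_mono[OF near[of x] K0[of x]] K0[of x]
        by (simp add: distrib_left sum_distrib_left mult_ac)
    qed
    also have "\<dots> = e / 2 + C * (\<Sum>i\<in>UNIV. LINT x|lborel. K x * (vec_nth x i)\<^sup>2)"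
      using Kint K2int by (simp add: has_bochner_integral_iff)
    also have "\<dots> \<le> e / 2 + C * (\<Sum>i\<in>(UNIV::'n set). 1 / (4 * real (Suc N)))"
      by (intro add_left_mono mult_left_mono C0 sum_mono K2)
    also have "\<dots> = e / 2 + C * n / 4 / Suc N" by (simp add: n_def)
    also have "\<dots> < e"
    proof -
      have "C * n / 4 / (e / 2) < Suc N" using N0 \<open>N \<ge> N0\<close> by simp
      then have "C * n / 4 < Suc N * (e / 2)" using e by (subst (asm) pos_divide_less_eq) auto
      then have "C * n / 4 / Suc N < e / 2" by (subst pos_divide_less_eq) (auto simp: mult.commute)
      then show ?thesis by linarith
    qed
    finally show "norm ((LINT x|lborel. indicator half_cube x *\<^sub>R (g x * of_real (fejer_vec (Suc N) x))) - g 0) < e" .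
  qed
qed

section \<open>Decay on the space and on the integer lattice\<close>

definition decay_weight :: "real ^ 'n::finite \<Rightarrow> real" where
  "decay_weight x = (\<Prod>i\<in>UNIV. 1 / (1 + (vec_nth x i)\<^sup>2))"

lemma decay_weight_pos: "decay_weight x > 0"
  unfolding decay_weight_def by (intro prod_pos) (simp add: add_pos_nonneg)

lemma decay_weight_le_1: "decay_weight x \<le> 1"
  unfolding decay_weight_def by (intro prod_le_1) (simp add: add_pos_nonneg)

lemma decay_weight_measurable [measurable]: "decay_weight \<in> borel_measurable borel"
  unfolding decay_weight_def by measurable

text \<open>The weight is a product so that both this integral and the lattice sum below split into
  one-variable factors.\<close>

lemma integrable_decay_weight: "integrable lborel (decay_weight :: real ^ 'n::finite \<Rightarrow> real)"
proof (rule integrableI_bounded)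
  have "integrable lborel (\<lambda>x::real. 1 / (1 + x\<^sup>2))"
    using integrable_inverse_1_plus_square by (simp add: set_integrable_def inverse_eq_divide)
  then have "(\<integral>\<^sup>+x. ennreal (1 / (1 + x\<^sup>2)) \<partial>(lborel::real measure)) < \<infinity>"
    by (simp add: integrable_iff_bounded)
  moreover have "(\<integral>\<^sup>+x. ennreal (norm (decay_weight x)) \<partial>(lborel::(real^'n) measure)) =
    (\<Prod>i\<in>(UNIV::'n set). (\<integral>\<^sup>+x. ennreal (1 / (1 + x\<^sup>2)) \<partial>lborel))"
  proof -
    have "(\<integral>\<^sup>+x. ennreal (norm (decay_weight x)) \<partial>(lborel::(real^'n) measure)) =
        (\<integral>\<^sup>+x. (\<Prod>i\<in>UNIV. ennreal (1 / (1 + (vec_nth x i)\<^sup>2))) \<partial>(lborel::(real^'n) measure))"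
      by (intro nn_integral_cong, subst prod_ennreal)
        (auto simp: decay_weight_pos less_imp_le, simp add: decay_weight_def)
    then show ?thesis using nn_integral_lborel_vec_prod[of "\<lambda>(_::'n) x. ennreal (1 / (1 + x\<^sup>2))"] by simp
  qed
  ultimately show "(\<integral>\<^sup>+x. ennreal (norm (decay_weight x)) \<partial>(lborel::(real^'n) measure)) < \<infinity>"
    by (simp add: ennreal_prod_eq_top less_top power_less_top_ennreal)
qed measurable

text \<open>Up to a constant, the weight at a lattice point bounds the weight on the whole cube
  around it, so that decay of a function turns into a summable bound over the cubes.\<close>

lemma decay_weight_translate_le:
  assumes "x \<in> half_cube"
  shows "decay_weight (int_vec m + x) \<le> 2 ^ CARD('n) * decay_weight (int_vec m :: real ^ 'n::finite)"
proof -
  have "decay_weight (int_vec m + x) \<le> (\<Prod>i\<in>(UNIV::'n set). 2 * (1 / (1 + (of_int (m i))\<^sup>2)))"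
    unfolding decay_weight_def
  proof (intro prod_mono conjI)
    fix i
    define y where "y = vec_nth x i"
    have "\<bar>y\<bar> \<le> 1 / 2" using assms unfolding half_cube_def y_def abs_le_iff
      by (auto simp: minus_le_iff dest!: spec[of _ i])
    then have y: "y\<^sup>2 \<le> 1 / 4" using power_mono[of "\<bar>y\<bar>" "1/2" 2] by (simp add: power2_eq_square)
    define k where "k = real_of_int (m i)"
    \<comment> \<open>\<open>2 * (k + y)\<^sup>2 - k\<^sup>2 = (k + 2 * y)\<^sup>2 - 2 *
      y\<^sup>2\<close>, and \<open>2 * y\<^sup>2 \<le> 1 / 2\<close>.\<close>
    have "0 \<le> (k + 2 * y)\<^sup>2" by simp
    then have "1 + k\<^sup>2 \<le> 2 * (1 + (k + y)\<^sup>2)" using y by (simp add: power2_eq_square algebra_simps)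
    then have "1 / (1 + (k + y)\<^sup>2) \<le> 2 * (1 / (1 + k\<^sup>2))"
      by (simp add: field_simps add_pos_nonneg)
    then show "1 / (1 + (vec_nth (int_vec m + x) i)\<^sup>2) \<le> 2 * (1 / (1 + (of_int (m i))\<^sup>2))"
      by (simp add: k_def y_def)
  qed (simp add: add_pos_nonneg)
  also have "\<dots> = 2 ^ CARD('n) * decay_weight (int_vec m :: real ^ 'n)"
    unfolding prod.distrib by (simp add: decay_weight_def)
  finally show ?thesis .
qed

lemma abs_summable_on_inverse_square_int:
  "Infinite_Set_Sum.abs_summable_on (\<lambda>m::int. 1 / (1 + (real_of_int m)\<^sup>2)) (UNIV)"
proof -
  have "Infinite_Set_Sum.abs_summable_on (\<lambda>n::nat. 1 / (1 + (real n)\<^sup>2)) (UNIV)"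
    unfolding abs_summable_on_nat_iff'
  proof (rule summable_comparison_test_ev)
    show "summable (\<lambda>n. 1 / (real n)\<^sup>2)" using inverse_power_summable[of 2, where 'a = real] by (simp add: inverse_eq_divide)
    show "\<forall>\<^sub>F n in sequentially. norm (norm (1 / (1 + (real n)\<^sup>2))) \<le> 1 / (real n)\<^sup>2"
      using eventually_gt_at_top[of 0] by eventually_elim (auto intro!: divide_left_mono simp: add_pos_nonneg)
  qed
  then have 1: "Infinite_Set_Sum.abs_summable_on (\<lambda>m::int. 1 / (1 + (real_of_int m)\<^sup>2)) ((int ` UNIV))"
    and 2: "Infinite_Set_Sum.abs_summable_on (\<lambda>m::int. 1 / (1 + (real_of_int m)\<^sup>2)) (((\<lambda>n. - int n) ` UNIV))"
    by (subst abs_summable_on_reindex_iff[symmetric]; auto simp: inj_on_def)+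
  have "UNIV = int ` UNIV \<union> (\<lambda>n. - int n) ` UNIV"
    by (auto simp: image_iff) (metis int_cases2)
  then show ?thesis using abs_summable_on_union[OF 1 2] by simp
qed

lemma decay_weight_abs_summable:
  "Infinite_Set_Sum.abs_summable_on (\<lambda>m. decay_weight (int_vec m :: real ^ 'n::finite)) (UNIV)"
proof -
  have "Infinite_Set_Sum.abs_summable_on (\<lambda>m. \<Prod>i\<in>(UNIV::'n set). 1 / (1 + (real_of_int (m i))\<^sup>2)) (PiE UNIV (\<lambda>_. UNIV))"
    by (rule abs_summable_on_prod_PiE) (auto simp: abs_summable_on_inverse_square_int)
  then show ?thesis by (simp add: decay_weight_def PiE_UNIV_domain)
qed

section \<open>Poisson summation\<close>

lemma fejer_le: "fejer N x \<le> N"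
proof -
  have "norm (\<Sum>j<N. cis (2 * pi * real j * x)) \<le> (\<Sum>j<N. norm (cis (2 * pi * real j * x)))"
    by (rule norm_sum)
  then have "(norm (\<Sum>j<N. cis (2 * pi * real j * x)))\<^sup>2 \<le> (real N)\<^sup>2"
    by (intro power_mono) auto
  then show ?thesis by (cases "N = 0") (simp_all add: fejer_def field_simps power2_eq_square)
qed

lemma fejer_vec_le: "fejer_vec N (x :: real ^ 'n::finite) \<le> real N ^ CARD('n)"
proof -
  have "fejer_vec N x \<le> (\<Prod>i\<in>(UNIV::'n set). real N)"
    unfolding fejer_vec_def by (intro prod_mono) (auto simp: fejer_nonneg fejer_le)
  then show ?thesis by simp
qed

lemma integrable_mult_fejer_vec:
  fixes F :: "real ^ 'n::finite \<Rightarrow> complex"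
  assumes F: "integrable lborel F"
  shows "integrable lborel (\<lambda>x. F x * of_real (fejer_vec N x))"
proof (rule Bochner_Integration.integrable_bound)
  show "integrable lborel (\<lambda>x. of_real (real N ^ CARD('n)) * F x)" using F by simp
  have [measurable]: "F \<in> borel_measurable borel" using borel_measurable_integrable[OF F] by simp
  show "(\<lambda>x. F x * of_real (fejer_vec N x)) \<in> borel_measurable lborel" by measurable
  show "AE x in lborel. norm (F x * of_real (fejer_vec N x)) \<le> norm (of_real (real N ^ CARD('n)) * F x)"
  proof (intro AE_I2)
    fix x
    show "norm (F x * of_real (fejer_vec N x)) \<le> norm (of_real (real N ^ CARD('n)) * F x)"
      using mult_right_mono[OF fejer_vec_le[of N x] norm_ge_zero[of "F x"]]
      by (simp add: norm_mult norm_power mult.commute fejer_vec_nonneg)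
  qed
qed

lemma integrable_of_decay:
  fixes F :: "real ^ 'n::finite \<Rightarrow> 'b::{banach, second_countable_topology}"
  assumes [measurable]: "F \<in> borel_measurable borel" and bound: "\<And>x. norm (F x) \<le> C * decay_weight x"
  shows "integrable lborel F"
proof (rule Bochner_Integration.integrable_bound)
  show "integrable lborel (\<lambda>x :: real ^ 'n. C * decay_weight x)" by (intro integrable_mult_right integrable_decay_weight)
  show "AE x in lborel. norm (F x) \<le> norm (C * decay_weight x)"
    using bound by (auto intro!: AE_I2 order_trans[OF _ abs_ge_self])
qed measurable

text \<open>The integral is cut into unit cubes. By periodicity each cube carries the same kernel of
  mass 1 concentrating at the lattice point, so its contribution tends to
  \<open>F (int_vec m)\<close>; dominated convergence over the counting measure yields the
  sum.\<close>

lemma fejer_sum_tendsto: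
  fixes F :: "real ^ 'n::finite \<Rightarrow> complex"
  assumes cont: "continuous_on UNIV F" and bound: "\<And>x. norm (F x) \<le> C * decay_weight x"
  shows "(\<lambda>N. LINT x|lborel. F x * of_real (fejer_vec (Suc N) x)) \<longlonglongrightarrow> infsum (\<lambda>m. F (int_vec m)) UNIV"
proof -
  have [measurable]: "F \<in> borel_measurable borel" using cont by (rule borel_measurable_continuous_onI)
  have int: "integrable lborel F" using bound by (rule integrable_of_decay[rotated]) measurable
  have C0: "C \<ge> 0"
    using bound[of 0] decay_weight_pos[of "0 :: real ^ 'n"] norm_ge_zero[of "F 0"]
    by (metis order_trans zero_le_mult_iff less_le_not_le)
  define s where "s = (\<lambda>N (m :: 'n \<Rightarrow> int). LINT x|lborel. indicator half_cube x *\<^sub>R (F (int_vec m + x) * of_real (fejer_vec (Suc N) x)))"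
  \<comment> \<open>A summable bound for \<open>F\<close> on the cube around \<open>m\<close>. It
    bounds \<open>s N m\<close> for every \<open>N\<close>, since the kernel has mass 1 on the
    cube.\<close>
  define W where "W = (\<lambda>m :: 'n \<Rightarrow> int. C * (2 ^ CARD('n) * decay_weight (int_vec m :: real ^ 'n)))"
  have W: "Infinite_Set_Sum.abs_summable_on W UNIV"
    unfolding W_def by (intro abs_summable_on_cmult_right decay_weight_abs_summable)
  have on_cube: "norm (F (int_vec m + x)) \<le> W m" if "x \<in> half_cube" for m x
    using bound[of "int_vec m + x"] mult_left_mono[OF decay_weight_translate_le[OF that, of m] C0]
    unfolding W_def by linarith
  have W0: "W m \<ge> 0" for m
    unfolding W_def using C0 decay_weight_pos[of "int_vec m :: real ^ 'n"] by simp
  have Kint: "has_bochner_integral lborel (\<lambda>x :: real ^ 'n. indicator half_cube x * fejer_vec (Suc N) x) 1" for N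
  proof (rule has_bochner_integral_nn_integral)
    show "(\<integral>\<^sup>+x. ennreal (indicator half_cube x * fejer_vec (Suc N) x) \<partial>(lborel :: (real ^ 'n) measure)) = ennreal 1"
      using nn_integral_fejer_vec[of "Suc N", where 'n = 'n] by simp
  qed (auto simp: fejer_vec_nonneg)
  have "norm (s N m) \<le> W m" for N m
  proof -
    have "norm (s N m) \<le> (LINT x|lborel. norm (indicator half_cube x *\<^sub>R (F (int_vec m + x) * of_real (fejer_vec (Suc N) x))))"
      unfolding s_def by (rule integral_norm_bound)
    also have "\<dots> \<le> (LINT x|lborel. W m * (indicator half_cube (x :: real ^ 'n) * fejer_vec (Suc N) x))"
    proof (rule integral_mono')
      show "integrable lborel (\<lambda>x :: real ^ 'n. W m * (indicator half_cube x * fejer_vec (Suc N) x))"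
        using Kint by (simp add: has_bochner_integral_iff)
      show "norm (indicator half_cube x *\<^sub>R (F (int_vec m + x) * of_real (fejer_vec (Suc N) x)))
          \<le> W m * (indicator half_cube x * fejer_vec (Suc N) x)" for x :: "real ^ 'n"
        using on_cube[of x m] by (auto simp: indicator_def norm_mult fejer_vec_nonneg intro!: mult_right_mono)
      show "0 \<le> W m * (indicator half_cube x * fejer_vec (Suc N) x)" for x :: "real ^ 'n"
        by (intro mult_nonneg_nonneg W0 fejer_vec_nonneg) auto
    qed
    also have "\<dots> = W m" using Kint[of N] by (simp add: has_bochner_integral_iff)
    finally show ?thesis .
  qed
  moreover have "(\<lambda>N. s N m) \<longlonglongrightarrow> F (int_vec m)" for m
  proof -
    have "continuous_on UNIV (\<lambda>x. F (int_vec m + x))"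
      by (rule continuous_on_compose2[OF cont]) (auto intro!: continuous_intros)
    then have "isCont (\<lambda>x. F (int_vec m + x)) 0" by (simp add: continuous_on_eq_continuous_at)
    moreover have "norm (F (int_vec m + x)) \<le> C" for x
      using bound[of "int_vec m + x"] mult_left_mono[OF decay_weight_le_1[of "int_vec m + x"] C0] by simp
    ultimately show ?thesis
      unfolding s_def using fejer_vec_approximate_identity[of "\<lambda>x. F (int_vec m + x)" C] by simp
  qed
  ultimately have "(\<lambda>N. LINT m|count_space UNIV. s N m) \<longlonglongrightarrow> (LINT m|count_space UNIV. F (int_vec m))"
    using W by (intro integral_dominated_convergence[where w = W]) (auto simp: abs_summable_on_def)
  moreover have "(LINT m|count_space UNIV. s N m) = (LINT x|lborel. F x * of_real (fejer_vec (Suc N) x))" for N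
    unfolding s_def
    by (subst integral_eq_sum_over_cubes[OF integrable_mult_fejer_vec[OF int]]) (simp add: fejer_vec_plus_int_vec)
  moreover have "(LINT m|count_space UNIV. F (int_vec m)) = infsum (\<lambda>m. F (int_vec m)) UNIV"
  proof -
    have "Infinite_Set_Sum.abs_summable_on (\<lambda>m. F (int_vec m)) UNIV"
    proof (rule abs_summable_on_comparison_test[OF W])
      show "norm (F (int_vec m)) \<le> norm (W m)" for m
        using on_cube[of 0 m] W0[of m] by (simp add: half_cube_def)
    qed
    then show ?thesis using infsetsum_infsum by (simp add: infsetsum_def)
  qed
  ultimately show ?thesis by simp
qed

text \<open>Complex-valued arguments are allowed because the twisted function
  \<open>h x * cis (2 * pi * inner x a)\<close> is complex.\<close>

definition fourier_complex :: "('a::euclidean_space \<Rightarrow> complex) \<Rightarrow> 'a \<Rightarrow> complex" where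
  "fourier_complex F \<xi> = (LINT x|lborel. F x * cis (- 2 * pi * inner x \<xi>))"

section \<open>Fourier coefficients in the Fejer means\<close>

lemma prod_cis: "(\<Prod>i\<in>A. cis (f i)) = cis (\<Sum>i\<in>A. f i)"
  by (induction A rule: infinite_finite_induct) (simp_all add: cis_mult)

text \<open>A term of the expanded product kernel picks a pair of indices in each coordinate, and
  this is its frequency. The Fejer weights thus appear as multiplicities: a frequency
  \<open>k\<close> arises from \<open>N - \<bar>k i\<bar>\<close> pairs in coordinate
  \<open>i\<close>.\<close>

definition freq :: "('n \<Rightarrow> nat \<times> nat) \<Rightarrow> 'n \<Rightarrow> int" where
  "freq p i = int (snd (p i)) - int (fst (p i))"

definition freqs :: "nat \<Rightarrow> ('n \<Rightarrow> nat \<times> nat) set" where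
  "freqs N = PiE UNIV (\<lambda>_. {..<N} \<times> {..<N})"

lemma finite_freqs: "finite (freqs N :: ('n::finite \<Rightarrow> nat \<times> nat) set)"
  unfolding freqs_def by (intro finite_PiE) auto

lemma fejer_complex:
  "of_real (fejer N x) = (\<Sum>p\<in>{..<N} \<times> {..<N}. cis (- 2 * pi * (x * of_int (int (snd p) - int (fst p))))) / N"
proof -
  have "complex_of_real ((norm (\<Sum>j<N. cis (2 * pi * real j * x)))\<^sup>2) =
      (\<Sum>j<N. \<Sum>l<N. cis (2 * pi * real j * x) * cis (- (2 * pi * real l * x)))"
    unfolding complex_norm_square by (simp add: cis_cnj sum_product)
  also have "\<dots> = (\<Sum>p\<in>{..<N} \<times> {..<N}. cis (- 2 * pi * (x * of_int (int (snd p) - int (fst p)))))"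
    unfolding sum.cartesian_product
    by (intro sum.cong) (auto simp: cis_mult algebra_simps)
  finally show ?thesis by (simp add: fejer_def)
qed

lemma fejer_vec_complex:
  "of_real (fejer_vec N (x :: real ^ 'n::finite)) =
    (\<Sum>p\<in>freqs N. cis (- 2 * pi * inner x (int_vec (freq p)))) / N ^ CARD('n)"
proof -
  have "complex_of_real (fejer_vec N x) = (\<Prod>i\<in>UNIV. (\<Sum>p\<in>{..<N} \<times> {..<N}. cis (- 2 * pi * (vec_nth x i * of_int (int (snd p) - int (fst p))))) / N)"
    by (simp add: fejer_vec_def fejer_complex del: of_int_diff)
  also have "\<dots> = (\<Prod>i\<in>UNIV. (\<Sum>p\<in>{..<N} \<times> {..<N}. cis (- 2 * pi * (vec_nth x i * of_int (int (snd p) - int (fst p)))))) / N ^ CARD('n)"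
    by (simp add: prod_dividef del: of_int_diff)
  also have "(\<Prod>i\<in>UNIV. (\<Sum>p\<in>{..<N} \<times> {..<N}. cis (- 2 * pi * (vec_nth x i * of_int (int (snd p) - int (fst p)))))) =
      (\<Sum>p\<in>freqs N. \<Prod>i\<in>UNIV. cis (- 2 * pi * (vec_nth x i * of_int (freq p i))))"
    unfolding freqs_def freq_def by (rule prod_sum_PiE) auto
  also have "\<dots> = (\<Sum>p\<in>freqs N. cis (- 2 * pi * inner x (int_vec (freq p))))"
    by (simp add: prod_cis inner_vec_def sum_distrib_left sum_negf)
  finally show ?thesis .
qed

lemma integral_mult_fejer_vec:
  fixes F :: "real ^ 'n::finite \<Rightarrow> complex"
  assumes F: "integrable lborel F"
  shows "(LINT x|lborel. F x * of_real (fejer_vec N x)) =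
    (\<Sum>p\<in>freqs N. fourier_complex F (int_vec (freq p))) / N ^ CARD('n)"
proof -
  have [measurable]: "F \<in> borel_measurable borel" using borel_measurable_integrable[OF F] by simp
  have [measurable]: "cis \<in> borel_measurable borel"
    by (intro borel_measurable_continuous_onI continuous_intros)
  have "integrable lborel (\<lambda>x. F x * cis (- 2 * pi * inner x \<xi>))" for \<xi>
    by (rule Bochner_Integration.integrable_bound[OF F]) (auto simp: norm_mult)
  then show ?thesis
    unfolding fejer_vec_complex fourier_complex_def
    by (simp add: sum_distrib_left times_divide_eq_right)
qed

text \<open>Every Fejer mean is a combination of the vanishing coefficients, hence so is the limit
  of the means, which is the lattice sum.\<close>

theorem poisson_zero:
  fixes F :: "real ^ 'n::finite \<Rightarrow> complex"
  assumes cont: "continuous_on UNIV F" and bound: "\<And>x. norm (F x) \<le> C * decay_weight x"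
    and zero: "\<And>k. fourier_complex F (int_vec k) = 0"
  shows "infsum (\<lambda>m. F (int_vec m)) UNIV = 0"
proof -
  have [measurable]: "F \<in> borel_measurable borel" using cont by (rule borel_measurable_continuous_onI)
  have int: "integrable lborel F" using bound by (rule integrable_of_decay[rotated]) measurable
  show ?thesis
    using fejer_sum_tendsto[OF cont bound] by (simp add: integral_mult_fejer_vec[OF int] zero LIMSEQ_const_iff)
qed

text \<open>The exact count is the product of the \<open>N - \<bar>k i\<bar>\<close>; the cruder
  bound, divided by \<open>N ^ CARD('n)\<close>, still tends to 1 for fixed
  \<open>M\<close>.\<close>

lemma card_freqs_ge:
  assumes "\<And>i. \<bar>k i\<bar> \<le> int M" "M \<le> N"
  shows "card {p \<in> freqs N. freq p = (k :: 'n::finite \<Rightarrow> int)} \<ge> (N - M) ^ CARD('n)"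
proof -
  define B where "B = (\<lambda>i. {q \<in> {..<N} \<times> {..<N}. int (snd q) - int (fst q) = k i})"
  have eq: "{p \<in> freqs N. freq p = k} = PiE UNIV B"
  proof -
    have "p \<in> freqs N \<and> freq p = k \<longleftrightarrow> (\<forall>i. p i \<in> B i)" for p
      unfolding freqs_def B_def PiE_UNIV_domain Pi_iff by (simp add: freq_def fun_eq_iff all_conj_distrib)
    then show ?thesis by (simp add: set_eq_iff PiE_UNIV_domain Pi_iff)
  qed
  have "N - M \<le> card (B i)" for i
  proof -
    \<comment> \<open>The shifts are the negative and the positive part of \<open>k i\<close>: the
      difference is \<open>k i\<close>, and shifts of at most \<open>M\<close> keep both entries
      below \<open>N\<close>.\<close>
    have "(\<lambda>a. (a + nat (- k i), a + nat (k i))) ` {..<N - M} \<subseteq> B i"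
      using assms(1)[of i] by (auto simp: B_def)
    moreover have "finite (B i)" unfolding B_def by simp
    moreover have "inj_on (\<lambda>a. (a + nat (- k i), a + nat (k i))) {..<N - M}" by (auto simp: inj_on_def)
    ultimately have "card {..<N - M} \<le> card (B i)" by (intro card_inj_on_le)
    then show ?thesis by simp
  qed
  then have "(\<Prod>i\<in>(UNIV::'n set). N - M) \<le> (\<Prod>i\<in>UNIV. card (B i))"
    by (intro prod_mono) auto
  then show ?thesis unfolding eq by (simp add: card_PiE)
qed

lemma card_freqs_zero: "card {p \<in> freqs N. freq p = (\<lambda>_::'n::finite. 0)} = N ^ CARD('n)"
proof -
  have "{p \<in> freqs N. freq p = (\<lambda>_::'n. 0)} = PiE UNIV (\<lambda>_. (\<lambda>a. (a, a)) ` {..<N})"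
  proof -
    have diag: "q \<in> (\<lambda>a. (a, a)) ` {..<N} \<longleftrightarrow> q \<in> {..<N} \<times> {..<N} \<and> int (snd q) - int (fst q) = 0" for q
      by (cases q) auto
    have "p \<in> freqs N \<and> freq p = (\<lambda>_. 0) \<longleftrightarrow> (\<forall>i. p i \<in> (\<lambda>a. (a, a)) ` {..<N})" for p :: "'n \<Rightarrow> nat \<times> nat"
      unfolding diag freqs_def PiE_UNIV_domain Pi_iff by (simp add: freq_def fun_eq_iff all_conj_distrib)
    then show ?thesis by (simp add: set_eq_iff PiE_UNIV_domain Pi_iff)
  qed
  then show ?thesis by (simp add: card_PiE card_image inj_on_def)
qed

text \<open>In the Fejer means the coefficient at 0 has weight exactly 1, the weight of the one at
  \<open>k\<close> tends to 1, and all others have nonpositive real part and are dropped before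
  passing to the limit.\<close>

theorem poisson_le:
  fixes F :: "real ^ 'n::finite \<Rightarrow> complex"
  assumes cont: "continuous_on UNIV F" and bound: "\<And>x. norm (F x) \<le> C * decay_weight x"
    and nonpos: "\<And>k. k \<noteq> (\<lambda>_. 0) \<Longrightarrow> Re (fourier_complex F (int_vec k)) \<le> 0"
    and k: "k \<noteq> (\<lambda>_. 0)"
  shows "Re (infsum (\<lambda>m. F (int_vec m)) UNIV) \<le> Re (fourier_complex F 0) + Re (fourier_complex F (int_vec k))"
proof -
  have [measurable]: "F \<in> borel_measurable borel" using cont by (rule borel_measurable_continuous_onI)
  have int: "integrable lborel F" using bound by (rule integrable_of_decay[rotated]) measurable
  define n where "n = CARD('n)"
  define f where "f = (\<lambda>k. Re (fourier_complex F (int_vec k)))"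
  have f0: "f (\<lambda>_. 0) = Re (fourier_complex F 0)"
    by (simp add: f_def)
  define M where "M = nat (Max (range (\<lambda>i. \<bar>k i\<bar>)))"
  have M: "\<bar>k i\<bar> \<le> int M" for i
  proof -
    have "\<bar>k i\<bar> \<le> Max (range (\<lambda>i. \<bar>k i\<bar>))" by (intro Max_ge) auto
    then show ?thesis unfolding M_def by linarith
  qed
  have le: "(\<Sum>p\<in>freqs N. f (freq p)) / real N ^ n \<le> f (\<lambda>_. 0) + (real (N - M) / N) ^ n * f k" if N: "N > M" for N
  proof -
    define D where "D = {p \<in> freqs N. freq p = (\<lambda>_::'n. 0)}"
    define E where "E = {p \<in> freqs N. freq p = k}"
    have fin: "finite D" "finite E" unfolding D_def E_def by (simp_all add: finite_freqs)
    have dis: "D \<inter> E = {}" using k by (auto simp: D_def E_def)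
    have "(\<Sum>p\<in>freqs N. f (freq p)) = (\<Sum>p\<in>freqs N - (D \<union> E). f (freq p)) + (\<Sum>p\<in>D \<union> E. f (freq p))"
      by (intro sum.subset_diff) (auto simp: D_def E_def finite_freqs)
    also have "(\<Sum>p\<in>freqs N - (D \<union> E). f (freq p)) \<le> 0"
      by (intro sum_nonpos) (auto simp: D_def f_def nonpos)
    also have "(\<Sum>p\<in>D \<union> E. f (freq p)) = (\<Sum>p\<in>D. f (freq p)) + (\<Sum>p\<in>E. f (freq p))"
      using fin dis by (rule sum.union_disjoint)
    also have "(\<Sum>p\<in>D. f (freq p)) = real (N ^ n) * f (\<lambda>_. 0)"
      unfolding n_def card_freqs_zero[symmetric] D_def[symmetric] by (simp add: D_def)
    also have "(\<Sum>p\<in>E. f (freq p)) = real (card E) * f k"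
      by (simp add: E_def)
    \<comment> \<open>A lower bound on the multiplicity gives an upper bound on the product because
      \<open>f k \<le> 0\<close>.\<close>
    also have "\<dots> \<le> real ((N - M) ^ n) * f k"
    proof (rule mult_right_mono_neg)
      have "(N - M) ^ n \<le> card E"
        unfolding E_def n_def using M N by (intro card_freqs_ge) auto
      then show "real ((N - M) ^ n) \<le> real (card E)" by (simp only: of_nat_le_iff)
      show "f k \<le> 0" using nonpos[OF k] by (simp add: f_def)
    qed
    finally have "(\<Sum>p\<in>freqs N. f (freq p)) \<le> real N ^ n * f (\<lambda>_. 0) + real (N - M) ^ n * f k"
      by (simp only: of_nat_power add_0)
    then have "(\<Sum>p\<in>freqs N. f (freq p)) / real N ^ n \<le> (real N ^ n * f (\<lambda>_. 0) + real (N - M) ^ n * f k) / real N ^ n"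
      by (intro divide_right_mono) auto
    also have "\<dots> = f (\<lambda>_. 0) + (real (N - M) / N) ^ n * f k"
      using N by (simp add: add_divide_distrib power_divide)
    finally show ?thesis .
  qed
  have "(\<lambda>N. Re ((\<Sum>p\<in>freqs (Suc N). fourier_complex F (int_vec (freq p))) / (Suc N) ^ CARD('n)))
      \<longlonglongrightarrow> Re (infsum (\<lambda>m. F (int_vec m)) UNIV)"
    using fejer_sum_tendsto[OF cont bound] unfolding integral_mult_fejer_vec[OF int] by (rule tendsto_Re)
  also have "(\<lambda>N. Re ((\<Sum>p\<in>freqs (Suc N). fourier_complex F (int_vec (freq p))) / (Suc N) ^ CARD('n))) =
      (\<lambda>N. (\<Sum>p\<in>freqs (Suc N). f (freq p)) / real (Suc N) ^ n)"
    by (simp only: Re_divide_of_nat Re_sum f_def n_def of_nat_power[symmetric])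
  finally have lim1: "(\<lambda>N. (\<Sum>p\<in>freqs (Suc N). f (freq p)) / real (Suc N) ^ n) \<longlonglongrightarrow> Re (infsum (\<lambda>m. F (int_vec m)) UNIV)" .
  have "(\<lambda>N. real (N - M) / N) \<longlonglongrightarrow> 1"
  proof (rule Lim_transform_eventually)
    show "(\<lambda>N. 1 - real M / real N) \<longlonglongrightarrow> 1"
      using tendsto_diff[OF tendsto_const lim_const_over_n, of 1 "real M"] by simp
    show "\<forall>\<^sub>F N in sequentially. 1 - real M / real N = real (N - M) / real N"
      by (rule eventually_mono[OF eventually_gt_at_top[of M]]) (simp add: of_nat_diff diff_divide_distrib)
  qed
  then have "(\<lambda>N. real (Suc N - M) / Suc N) \<longlonglongrightarrow> 1" by (rule LIMSEQ_Suc)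
  then have "(\<lambda>N. f (\<lambda>_. 0) + (real (Suc N - M) / Suc N) ^ n * f k) \<longlonglongrightarrow> f (\<lambda>_. 0) + 1 ^ n * f k"
    by (intro tendsto_intros)
  then have "Re (infsum (\<lambda>m. F (int_vec m)) UNIV) \<le> f (\<lambda>_. 0) + 1 ^ n * f k"
  proof (rule LIMSEQ_le[OF lim1], intro exI[of _ M] allI impI)
    fix N assume "N \<ge> M"
    then show "(\<Sum>p\<in>freqs (Suc N). f (freq p)) / real (Suc N) ^ n \<le> f (\<lambda>_. 0) + (real (Suc N - M) / Suc N) ^ n * f k"
      by (intro le) simp
  qed
  then show ?thesis by (simp add: f0) (simp add: f_def)
qed

section \<open>Stability of the rotated integer lattices\<close>

lemma independent_list_coeffs_zero:
  fixes vs :: "'a::real_vector list"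
  assumes "distinct vs" "independent (set vs)" "(\<Sum>i<length vs. w i *\<^sub>R vs ! i) = 0" "i < length vs"
  shows "w i = 0"
proof -
  define ix where "ix = the_inv_into {..<length vs} ((!) vs)"
  have bij: "bij_betw ((!) vs) {..<length vs} (set vs)"
    using assms(1) by (intro bij_betw_nth) auto
  have ix: "ix (vs ! j) = j" if "j < length vs" for j
    unfolding ix_def using bij that by (intro the_inv_into_f_f) (auto simp: bij_betw_def)
  have "(\<Sum>v\<in>set vs. w (ix v) *\<^sub>R v) = (\<Sum>i<length vs. w (ix (vs ! i)) *\<^sub>R vs ! i)"
    by (rule sum.reindex_bij_betw[OF bij, symmetric])
  also have "\<dots> = 0" using assms(3) by (simp add: ix)
  finally have "w (ix (vs ! i)) = 0"
    by (rule independentD[OF assms(2) finite_set subset_refl]) (use assms(4) in simp)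
  then show ?thesis using ix assms(4) by simp
qed

text \<open>In coordinates with respect to an orthonormal basis of the span, the Gram matrix is a
  square matrix \<open>A\<close> times its transpose. Its determinant is therefore a square, nonzero
  by independence.\<close>

lemma gram_det_pos:
  fixes vs :: "'a::euclidean_space list"
  assumes "distinct vs" "independent (set vs)"
  shows "gram_det vs > 0"
proof -
  define r where "r = length vs"
  obtain B where B: "pairwise real_inner_class.orthogonal B" "\<And>x. x \<in> B \<Longrightarrow> norm x = 1"
      "independent B" "card B = dim (span (set vs))" "span B = span (set vs)"
    using orthonormal_basis_subspace[of "span (set vs)"] by (metis subspace_span)
  have finB: "finite B" using B(3) by (rule independent_imp_finite)
  have "card B = r"
    using B(4) assms by (simp add: dim_eq_card_independent distinct_card r_def)
  then obtain es where es: "set es = B" "distinct es" "length es = r"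
    using finite_distinct_list[OF finB] distinct_card by metis
  have sum_es: "(\<Sum>j<r. f (es ! j)) = sum f B" for f :: "'a \<Rightarrow> 'b::comm_monoid_add"
    using sum.reindex_bij_betw[OF bij_betw_nth[OF es(2) refl refl], of f] es by simp
  have expand: "(\<Sum>b\<in>B. inner x b *\<^sub>R b) = x" if "x \<in> span (set vs)" for x
    using orthonormal_basis_expand[OF B(1,2) _ finB] that B(5) by simp
  have vs: "vs ! i \<in> span (set vs)" if "i < r" for i
    using that by (intro span_base) (simp add: r_def)
  define A where "A = Matrix.mat r r (\<lambda>(i, j). inner (vs ! i) (es ! j))"
  have A: "A \<in> carrier_mat r r" "transpose_mat A \<in> carrier_mat r r" by (simp_all add: A_def)
  have "Matrix.mat r r (\<lambda>(i, j). inner (vs ! i) (vs ! j)) = A * transpose_mat A"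
  proof (rule eq_matI)
    fix i j assume "i < dim_row (A * transpose_mat A)" "j < dim_col (A * transpose_mat A)"
    then have ij: "i < r" "j < r" by (simp_all add: A_def)
    have "inner (vs ! i) (vs ! j) = inner (\<Sum>b\<in>B. inner (vs ! i) b *\<^sub>R b) (vs ! j)"
      by (simp only: expand[OF vs[OF ij(1)]])
    also have "\<dots> = (\<Sum>b\<in>B. inner (vs ! i) b * inner (vs ! j) b)"
      by (simp add: inner_sum_left inner_sum_right inner_commute)
    also have "\<dots> = (\<Sum>k<r. inner (vs ! i) (es ! k) * inner (vs ! j) (es ! k))"
      by (rule sum_es[symmetric])
    finally show "Matrix.mat r r (\<lambda>(i, j). inner (vs ! i) (vs ! j)) $$ (i, j) = (A * transpose_mat A) $$ (i, j)"
      using ij by (simp add: A_def scalar_prod_def atLeast0LessThan)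
  qed (simp_all add: A_def)
  then have det: "gram_det vs = Determinant.det A * Determinant.det A"
    using A by (simp add: gram_det_def r_def[symmetric] Determinant.det_mult[of _ r] Determinant.det_transpose[of _ r])
  have "Determinant.det A \<noteq> 0"
  proof
    assume "Determinant.det A = 0"
    then have "Determinant.det (transpose_mat A) = 0" using A by (simp add: Determinant.det_transpose)
    \<comment> \<open>A kernel vector gives a combination \<open>x\<close> of the list that is
      orthogonal to an orthonormal basis of its span, so \<open>x = 0\<close>, and independence
      makes all coefficients vanish.\<close>
    then obtain w where w: "w \<in> carrier_vec r" "w \<noteq> 0\<^sub>v r" "transpose_mat A *\<^sub>v w = 0\<^sub>v r"
      using det_0_iff_vec_prod_zero_field[OF A(2)] by blast
    define x where "x = (\<Sum>i<r. vec_index w i *\<^sub>R vs ! i)"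
    have "inner x b = 0" if b: "b \<in> B" for b
    proof -
      obtain j where j: "j < r" "b = es ! j"
        using b es(1,3) in_set_conv_nth[of b es] by auto
      have "vec_index (transpose_mat A *\<^sub>v w) j = 0" using w(3) j by simp
      then have "(\<Sum>i<r. inner (vs ! i) (es ! j) * vec_index w i) = 0"
        using j w(1) by (simp add: A_def scalar_prod_def atLeast0LessThan)
      then show ?thesis by (simp add: x_def inner_sum_left j mult.commute)
    qed
    moreover have "x \<in> span (set vs)"
      unfolding x_def by (intro span_sum span_scale vs) simp
    ultimately have "x = 0" using expand[of x] by simp
    then have "vec_index w i = 0" if "i < r" for i
      using independent_list_coeffs_zero[OF assms, of "vec_index w"] that by (simp add: x_def r_def)
    then have "w = 0\<^sub>v r" using w(1) by (intro eq_vecI) auto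
    then show False using w(2) by simp
  qed
  then show ?thesis unfolding det by (simp add: zero_less_mult_iff linorder_neq_iff disj_commute)
qed

lemma gram_det_int:
  assumes "\<And>v w. v \<in> set vs \<Longrightarrow> w \<in> set vs \<Longrightarrow> inner v w \<in> \<int>"
  shows "gram_det vs \<in> \<int>"
proof -
  define r where "r = length vs"
  have "Matrix.mat r r (\<lambda>(i, j). inner (vs ! i) (vs ! j)) =
      map_mat real_of_int (Matrix.mat r r (\<lambda>(i, j). \<lfloor>inner (vs ! i) (vs ! j)\<rfloor>))"
    using assms by (intro eq_matI) (simp_all add: r_def)
  then show ?thesis by (simp add: gram_det_def r_def[symmetric] of_int_hom.hom_det)
qed

lemma standard_lattice_eq: "standard_lattice = range int_vec"
proof
  show "standard_lattice \<subseteq> (range int_vec :: (real ^ 'n) set)"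
  proof
    fix x :: "real ^ 'n" assume "x \<in> standard_lattice"
    then have "x = int_vec (\<lambda>i. \<lfloor>vec_nth x i\<rfloor>)"
      by (simp add: standard_lattice_def Finite_Cartesian_Product.vec_eq_iff)
    then show "x \<in> range int_vec" by (metis rangeI)
  qed
qed (auto simp: standard_lattice_def)

lemma inner_int_vec: "inner (int_vec k) (int_vec m :: real ^ 'n::finite) \<in> \<int>"
  by (auto simp: inner_vec_def intro!: Ints_sum)

lemma int_span_Basis:
  assumes "distinct bs" "set bs = (Basis :: (real ^ 'n::finite) set)"
  shows "int_span bs = (standard_lattice :: (real ^ 'n) set)"
proof -
  have sum_bs: "(\<Sum>j<length bs. f (bs ! j)) = sum f Basis" for f :: "real ^ 'n \<Rightarrow> real ^ 'n"
    using sum.reindex_bij_betw[OF bij_betw_nth[OF assms(1) refl refl], of f] assms by simp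
  have Basis_int: "vec_nth b i \<in> \<int>" if "b \<in> Basis" for b :: "real ^ 'n" and i
    using that by (auto simp: Basis_vec_def axis_def)
  show ?thesis
  proof
    show "int_span bs \<subseteq> standard_lattice"
    proof
      fix x assume "x \<in> int_span bs"
      then obtain c :: "nat \<Rightarrow> int" where x: "x = (\<Sum>i<length bs. of_int (c i) *\<^sub>R bs ! i)"
        unfolding int_span_def by blast
      have "vec_nth (bs ! j) i \<in> \<int>" if "j < length bs" for i j
        using that assms(2) Basis_int nth_mem by blast
      then show "x \<in> standard_lattice" unfolding x
        by (auto simp: standard_lattice_def intro!: Ints_sum Ints_mult)
    qed
    show "standard_lattice \<subseteq> int_span bs"
    proof
      fix x :: "real ^ 'n" assume x: "x \<in> standard_lattice"
      have "inner x b \<in> \<int>" if "b \<in> Basis" for b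
        using that x by (auto simp: Basis_vec_def standard_lattice_def inner_axis)
      then have "of_int \<lfloor>inner x (bs ! i)\<rfloor> = inner x (bs ! i)" if "i < length bs" for i
        using that assms(2) nth_mem by (intro of_int_floor) blast
      then have "(\<Sum>i<length bs. of_int \<lfloor>inner x (bs ! i)\<rfloor> *\<^sub>R bs ! i) = (\<Sum>i<length bs. inner x (bs ! i) *\<^sub>R bs ! i)"
        by (intro sum.cong) simp_all
      also have "\<dots> = (\<Sum>b\<in>Basis. inner x b *\<^sub>R b)"
        by (rule sum_bs)
      also have "\<dots> = x" by (rule euclidean_representation)
      finally show "x \<in> int_span bs"
        unfolding int_span_def by (intro range_eqI[of _ _ "\<lambda>i. \<lfloor>inner x (bs ! i)\<rfloor>"]) simp
    qed
  qed
qed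

text \<open>The rotated standard basis is orthonormal, so its Gram determinant is 1. A sublattice
  has an integral Gram matrix, and a positive integer determinant is at least 1.\<close>

lemma stable_orthogonal_image:
  fixes f :: "real ^ 'n::finite \<Rightarrow> real ^ 'n"
  assumes f: "orthogonal_transformation f"
  shows "stable (f ` standard_lattice)"
proof -
  interpret linear f using f by (rule orthogonal_transformation_linear)
  have inj: "inj f" using f by (rule orthogonal_transformation_inj)
  have ip: "inner (f x) (f y) = inner x y" for x y
    using f by (simp add: orthogonal_transformation_def)
  obtain bs :: "(real ^ 'n) list" where bs: "set bs = Basis" "distinct bs"
    using finite_distinct_list[OF finite_Basis] by blast
  define vs where "vs = map f bs"
  have set_vs: "set vs = f ` Basis" by (simp add: vs_def bs)
  have basis: "lattice_basis vs (f ` standard_lattice)"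
    unfolding lattice_basis_def
  proof (intro conjI)
    show "distinct vs" using bs by (simp add: vs_def distinct_map inj_on_subset[OF inj])
    show "independent (set vs)"
      unfolding set_vs using orthogonal_transformation_linear[OF f] independent_Basis inj_on_subset[OF inj subset_UNIV]
      by (rule linear_independent_injective_image)
    have "int_span vs = f ` int_span bs"
      unfolding int_span_def image_image vs_def by (intro image_cong refl) (simp add: sum scale)
    then show "f ` standard_lattice = int_span vs" using int_span_Basis[OF bs(2,1)] by simp
  qed
  have "gram_det vs = Determinant.det (1\<^sub>m (length vs))"
  proof -
    have "inner (vs ! i) (vs ! j) = (if i = j then 1 else 0)" if "i < length vs" "j < length vs" for i j
      using that bs nth_eq_iff_index_eq[OF bs(2), of i j] by (simp add: vs_def ip inner_Basis flip: bs(1))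
    then show ?thesis
      unfolding gram_det_def by (intro arg_cong[of _ _ Determinant.det] eq_matI) auto
  qed
  then have covol: "covol (f ` standard_lattice) = 1"
    using covol_eq[OF basis] by simp
  have "span (f ` standard_lattice) = UNIV"
  proof -
    have "b \<in> standard_lattice" if "b \<in> Basis" for b :: "real ^ 'n"
      using that by (auto simp: standard_lattice_def Basis_vec_def axis_def)
    then have "span (f ` Basis) \<subseteq> span (f ` standard_lattice)" by (intro span_mono) auto
    moreover have "span (f ` Basis) = f ` UNIV"
      by (simp add: linear_span_image[OF orthogonal_transformation_linear[OF f]])
    moreover have "f ` UNIV = UNIV" using orthogonal_transformation_surj[OF f] .
    ultimately show ?thesis by auto
  qed
  moreover have "covol M \<ge> 1" if M: "is_lattice M" "M \<subseteq> f ` standard_lattice" for M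
  proof -
    obtain ws where ws: "lattice_basis ws M" using M unfolding is_lattice_def by blast
    have "inner v w \<in> \<int>" if vw: "v \<in> set ws" "w \<in> set ws" for v w
    proof -
      have "set ws \<subseteq> M"
      proof
        fix v assume "v \<in> set ws"
        then obtain j where j: "j < length ws" "v = ws ! j" by (metis in_set_conv_nth)
        then have "v = (\<Sum>i<length ws. of_int (if i = j then 1 else 0) *\<^sub>R ws ! i)"
          by (simp add: if_distrib[of of_int] if_distrib[of "\<lambda>x. x *\<^sub>R _"] sum.delta cong: if_cong)
        then have "v \<in> int_span ws"
          unfolding int_span_def by (intro image_eqI[where x = "\<lambda>i. if i = j then 1 else 0"]) auto
        then show "v \<in> M" using ws by (simp add: lattice_basis_def)
      qed
      then obtain k m where "v = f (int_vec k)" "w = f (int_vec m)"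
        using vw M(2) unfolding standard_lattice_eq by blast
      then show ?thesis by (simp add: ip inner_int_vec)
    qed
    then have "gram_det ws \<in> \<int>" by (rule gram_det_int)
    moreover have "gram_det ws > 0"
      using ws by (intro gram_det_pos) (auto simp: lattice_basis_def)
    ultimately have "gram_det ws \<ge> 1" by (auto elim!: Ints_cases)
    then show ?thesis using covol_eq[OF ws] by simp
  qed
  ultimately show ?thesis
    using basis covol unfolding stable_def full_rank_lattice_def is_lattice_def by blast
qed

text \<open>Rotations preserve the integral inner products, so the same nonzero vectors can be
  tested in (i') and in (ii').\<close>

lemma orthogonal_image_subset_dual:
  fixes f :: "real ^ 'n::finite \<Rightarrow> real ^ 'n"
  assumes "orthogonal_transformation f"
  shows "f ` standard_lattice \<subseteq> dual_lattice (f ` standard_lattice)"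
  using assms by (auto simp: dual_lattice_def standard_lattice_eq orthogonal_transformation_def inner_int_vec)

section \<open>Theta constants\<close>

lemma infsum_product_real:
  fixes f :: "'a::countable \<Rightarrow> real" and g :: "'b::countable \<Rightarrow> real"
  assumes f: "Infinite_Sum.abs_summable_on f UNIV" and g: "Infinite_Sum.abs_summable_on g UNIV"
  shows "(\<lambda>(x, y). f x * g y) summable_on UNIV"
    and "infsum (\<lambda>(x, y). f x * g y) UNIV = infsum f UNIV * infsum g UNIV"
proof -
  have f': "Infinite_Set_Sum.abs_summable_on f UNIV" and g': "Infinite_Set_Sum.abs_summable_on g UNIV"
    using f g by (simp_all only: abs_summable_equivalent)
  have p: "Infinite_Set_Sum.abs_summable_on (\<lambda>(x, y). f x * g y) UNIV"
    using abs_summable_on_product[OF _ _ f' g'] by simp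
  then show "(\<lambda>(x, y). f x * g y) summable_on UNIV"
    by (rule abs_summable_summable[OF iffD2[OF abs_summable_equivalent]])
  show "infsum (\<lambda>(x, y). f x * g y) UNIV = infsum f UNIV * infsum g UNIV"
    using infsetsum_product[OF _ _ f' g'] infsetsum_infsum[OF f'] infsetsum_infsum[OF g'] infsetsum_infsum[OF p]
    by simp
qed

definition alt_sign :: "int \<Rightarrow> real" where
  "alt_sign m = (if even m then 1 else - 1)"

lemma abs_alt_sign [simp]: "\<bar>alt_sign m\<bar> = 1"
  by (simp add: alt_sign_def)

text \<open>\<open>theta3\<close> and \<open>theta4\<close> are Jacobi's theta constants at the nome
  \<open>exp (- t)\<close>.\<close>

definition theta3 :: "real \<Rightarrow> real" where
  "theta3 t = (\<Sum>\<^sub>\<infinity>m. exp (- t * (of_int m)\<^sup>2))"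

definition theta4 :: "real \<Rightarrow> real" where
  "theta4 t = (\<Sum>\<^sub>\<infinity>m. alt_sign m * exp (- t * (of_int m)\<^sup>2))"

lemma theta3_abs_summable:
  assumes "t > 0"
  shows "Infinite_Sum.abs_summable_on (\<lambda>m::int. exp (- t * (real_of_int m)\<^sup>2)) UNIV"
proof (rule Infinite_Sum.abs_summable_on_comparison_test)
  \<comment> \<open>With \<open>1 \<le> C\<close> and \<open>1 \<le> C * t\<close> one gets
    \<open>1 + y \<le> C * (1 + t * y) \<le> C * exp (t * y)\<close>, a comparison with inverse
    squares.\<close>
  define C where "C = max 1 (1 / t)"
  have C: "C \<ge> 1" "1 \<le> C * t"
    using assms mult_right_mono[of "1 / t" C t] by (auto simp: C_def)
  have "Infinite_Set_Sum.abs_summable_on (\<lambda>m::int. C * (1 / (1 + (real_of_int m)\<^sup>2))) UNIV"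
    by (intro abs_summable_on_cmult_right abs_summable_on_inverse_square_int)
  then show "Infinite_Sum.abs_summable_on (\<lambda>m::int. C * (1 / (1 + (real_of_int m)\<^sup>2))) UNIV"
    by (simp only: abs_summable_equivalent)
  fix m :: int
  define y where "y = (real_of_int m)\<^sup>2"
  have y: "y \<ge> 0" by (simp add: y_def)
  have "1 + y \<le> C * 1 + (C * t) * y"
    using C y mult_right_mono[of 1 "C * t" y] by simp
  also have "\<dots> = C * (1 + t * y)" by (simp add: algebra_simps)
  also have "\<dots> \<le> C * exp (t * y)" using C by (intro mult_left_mono exp_ge_add_one_self) auto
  finally have "1 + y \<le> C * exp (t * y)" .
  then have "exp (- t * y) \<le> C * (1 / (1 + y))"
    using y by (simp add: exp_minus field_simps add_pos_nonneg)
  also have "\<dots> \<le> norm (C * (1 / (1 + y)))" unfolding real_norm_def by (rule abs_ge_self)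
  finally show "norm (exp (- t * (real_of_int m)\<^sup>2)) \<le> norm (C * (1 / (1 + (real_of_int m)\<^sup>2)))"
    by (simp add: y_def)
qed

lemma theta4_abs_summable:
  assumes "t > 0"
  shows "Infinite_Sum.abs_summable_on (\<lambda>m::int. alt_sign m * exp (- t * (real_of_int m)\<^sup>2)) UNIV"
  using theta3_abs_summable[OF assms] by (simp add: abs_mult)

lemma theta3_summable: "t > 0 \<Longrightarrow> (\<lambda>m::int. exp (- t * (real_of_int m)\<^sup>2)) summable_on UNIV"
  by (rule abs_summable_summable[OF theta3_abs_summable])

lemma theta4_summable: "t > 0 \<Longrightarrow> (\<lambda>m::int. alt_sign m * exp (- t * (real_of_int m)\<^sup>2)) summable_on UNIV"
  by (rule abs_summable_summable[OF theta4_abs_summable])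

text \<open>Rotating \<open>\<int>\<^sup>2\<close> by 45 degrees: the pairs \<open>(x, y)\<close> with \<open>x + y\<close> odd cancel under
  \<open>(x, y) \<mapsto> (y, x)\<close>, and those with \<open>x + y\<close> even are \<open>(a + b, a - b)\<close>.\<close>

lemma theta3_mult_theta4:
  assumes "t > 0"
  shows "theta3 t * theta4 t = (theta4 (2 * t))\<^sup>2"
proof -
  define f where "f = (\<lambda>(x, y). exp (- t * (of_int x)\<^sup>2) * (alt_sign y * exp (- t * (of_int y)\<^sup>2)))"
  note fg = infsum_product_real[OF theta3_abs_summable[OF assms] theta4_abs_summable[OF assms]]
  have sf: "f summable_on UNIV" and sumf: "infsum f UNIV = theta3 t * theta4 t"
    using fg by (simp_all add: f_def theta3_def theta4_def)
  define A0 where "A0 = {(x, y). even (x + y :: int)}"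
  define A1 where "A1 = {(x, y). odd (x + y :: int)}"
  have "infsum f UNIV = infsum f (A0 \<union> A1)"
    by (rule arg_cong[of _ _ "infsum f"]) (auto simp: A0_def A1_def)
  also have "\<dots> = infsum f A0 + infsum f A1"
    by (rule infsum_Un_disjoint) (auto intro: summable_on_subset_banach[OF sf] simp: A0_def A1_def)
  also have "infsum f A1 = 0"
  proof -
    have "infsum f A1 = infsum (\<lambda>p. f (prod.swap p)) A1"
      by (rule infsum_reindex_bij_betw[symmetric], rule bij_betwI[of _ _ _ prod.swap]) (auto simp: A1_def add.commute)
    also have "\<dots> = infsum (\<lambda>p. - f p) A1"
      by (intro infsum_cong) (auto simp: A1_def f_def alt_sign_def)
    also have "\<dots> = - infsum f A1" by (rule infsum_uminus)
    finally show ?thesis by simp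
  qed
  also have "infsum f A0 = infsum (\<lambda>p. f (fst p + snd p, fst p - snd p)) UNIV"
  proof (rule infsum_reindex_bij_betw[symmetric])
    show "bij_betw (\<lambda>p. (fst p + snd p, fst p - snd p)) UNIV A0"
    proof (rule bij_betwI[of _ _ _ "\<lambda>p. ((fst p + snd p) div 2, (fst p - snd p) div 2)"])
      fix p assume "p \<in> A0"
      then obtain x y where p: "p = (x, y)" "even (x + y)" by (auto simp: A0_def)
      then obtain k where "x + y = 2 * k" by blast
      then have "y = 2 * k - x" by simp
      then show "(fst ((fst p + snd p) div 2, (fst p - snd p) div 2) + snd ((fst p + snd p) div 2, (fst p - snd p) div 2),
          fst ((fst p + snd p) div 2, (fst p - snd p) div 2) - snd ((fst p + snd p) div 2, (fst p - snd p) div 2)) = p"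
        using p by simp
    qed (auto simp: A0_def)
  qed
  also have "(\<lambda>p. f (fst p + snd p, fst p - snd p)) = (\<lambda>(a, b).
      (alt_sign a * exp (- (2 * t) * (of_int a)\<^sup>2)) * (alt_sign b * exp (- (2 * t) * (of_int b)\<^sup>2)))"
  proof (rule ext, safe)
    fix a b :: int
    \<comment> \<open>\<open>(a + b)\<^sup>2 + (a - b)\<^sup>2 = 2 * a\<^sup>2 + 2 *
      b\<^sup>2\<close>, which doubles the parameter.\<close>
    have "exp (- t * (of_int (a + b))\<^sup>2) * exp (- t * (of_int (a - b))\<^sup>2) =
        exp (- (2 * t) * (of_int a)\<^sup>2) * exp (- (2 * t) * (of_int b)\<^sup>2)"
      unfolding exp_add[symmetric] by (intro arg_cong[of _ _ exp]) (simp add: power2_eq_square algebra_simps)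
    moreover have "alt_sign (a - b) = alt_sign a * alt_sign b"
      by (simp add: alt_sign_def)
    ultimately show "f (fst (a, b) + snd (a, b), fst (a, b) - snd (a, b)) =
        (alt_sign a * exp (- (2 * t) * (of_int a)\<^sup>2)) * (alt_sign b * exp (- (2 * t) * (of_int b)\<^sup>2))"
      unfolding f_def fst_conv snd_conv prod.case by (simp only: mult_ac)
  qed
  also have "infsum \<dots> UNIV = (theta4 (2 * t))\<^sup>2"
    using infsum_product_real(2)[OF theta4_abs_summable theta4_abs_summable, of "2 * t" "2 * t"] assms
    by (simp add: theta4_def power2_eq_square)
  finally show ?thesis using sumf by simp
qed

text \<open>By the duplication identity a zero at \<open>t\<close> propagates to
  \<open>2 * t\<close>, \<open>4 * t\<close> and so on, whereas for a large parameter the term 1 at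
  \<open>m = 0\<close> outweighs all the others.\<close>

lemma theta4_nonzero:
  assumes t: "t > 0"
  shows "theta4 t \<noteq> 0"
proof
  assume "theta4 t = 0"
  then have zero: "theta4 (2 ^ k * t) = 0" for k
  proof (induction k)
    case (Suc k)
    then show ?case using theta3_mult_theta4[of "2 ^ k * t"] t by (simp add: mult.assoc)
  qed simp
  define N where "N = - {0::int}"
  define R where "R = (\<Sum>\<^sub>\<infinity>m\<in>N. exp (- t * (of_int m)\<^sup>2))"
  have R0: "R \<ge> 0" unfolding R_def by (intro infsum_nonneg) auto
  \<comment> \<open>Makes \<open>s - t\<close> exceed the tail \<open>R\<close>, so that
    \<open>R < exp (s - t)\<close>.\<close>
  obtain k where "(R + t) / t < 2 ^ k" using real_arch_pow[of 2 "(R + t) / t"] by auto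
  then have k: "R < 2 ^ k * t - t" using t by (simp add: divide_less_eq)
  define s where "s = 2 ^ k * t"
  have s: "s > t" "s > 0" using k R0 t unfolding s_def by linarith+
  have sum4: "(\<lambda>m. alt_sign m * exp (- s * (of_int m)\<^sup>2)) summable_on N"
    by (rule summable_on_subset_banach[OF theta4_summable]) (use s in auto)
  have sum3: "(\<lambda>m. exp (- (s - t)) * exp (- t * (of_int m)\<^sup>2)) summable_on N"
    by (intro summable_on_cmult_right summable_on_subset_banach[OF theta3_summable]) (use t in auto)
  have "theta4 s = infsum (\<lambda>m. alt_sign m * exp (- s * (of_int m)\<^sup>2)) ({0} \<union> N)"
    unfolding theta4_def N_def by (rule arg_cong[of _ _ "infsum _"]) auto
  also have "\<dots> = 1 + infsum (\<lambda>m. alt_sign m * exp (- s * (of_int m)\<^sup>2)) N"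
    by (subst infsum_Un_disjoint) (use sum4 in \<open>auto simp: N_def alt_sign_def\<close>)
  finally have "infsum (\<lambda>m. alt_sign m * exp (- s * (of_int m)\<^sup>2)) N = - 1"
    using zero[of k] by (simp add: s_def)
  moreover have "norm (infsum (\<lambda>m. alt_sign m * exp (- s * (of_int m)\<^sup>2)) N) \<le>
      infsum (\<lambda>m. exp (- (s - t)) * exp (- t * (of_int m)\<^sup>2)) N"
  proof (rule norm_infsum_le[OF has_sum_infsum[OF sum4] has_sum_infsum[OF sum3]])
    \<comment> \<open>As \<open>m\<^sup>2 \<ge> 1\<close>, a factor \<open>exp (- (s - t))\<close>
      can be split off each term, leaving the terms of \<open>R\<close>.\<close>
    fix m assume "m \<in> N"
    then have "1 \<le> \<bar>m\<bar>" by (auto simp: N_def)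
    then have "1 \<le> m\<^sup>2" by (metis one_le_power power2_abs)
    then have "1 \<le> (real_of_int m)\<^sup>2" by (metis of_int_1_le_iff of_int_power)
    then have "(s - t) * 1 \<le> (s - t) * (real_of_int m)\<^sup>2" using s by (intro mult_left_mono) auto
    then have "- s * (of_int m)\<^sup>2 \<le> - (s - t) + - t * (real_of_int m)\<^sup>2" by (simp add: algebra_simps)
    then show "norm (alt_sign m * exp (- s * (of_int m)\<^sup>2)) \<le> exp (- (s - t)) * exp (- t * (of_int m)\<^sup>2)"
      unfolding exp_add[symmetric] by (simp add: abs_mult)
  qed
  moreover have "infsum (\<lambda>m. exp (- (s - t)) * exp (- t * (of_int m)\<^sup>2)) N = exp (- (s - t)) * R"
    unfolding R_def by (rule infsum_cmult_right')
  moreover have "exp (- (s - t)) * R < 1"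
  proof -
    have "R < exp (s - t)" using k exp_ge_add_one_self[of "s - t"] unfolding s_def by linarith
    then have "exp (- (s - t)) * R < exp (- (s - t)) * exp (s - t)" by (intro mult_strict_left_mono) auto
    then show ?thesis by (simp flip: exp_add)
  qed
  ultimately show False by simp
qed

text \<open>The sum and the difference of the two constants have nonnegative terms;
  \<open>k = 0\<close> stands for the sum and \<open>k = 1\<close> for the difference, and the term
  at \<open>m = k\<close> is strictly positive.\<close>

lemma abs_theta4_less_theta3:
  assumes t: "t > 0"
  shows "\<bar>theta4 t\<bar> < theta3 t"
proof -
  note s3 = theta3_summable[OF t] and s4 = theta4_summable[OF t]
  have pos: "theta3 t + alt_sign k * theta4 t > 0" for k
  proof -
    note s4' = summable_on_cmult_right[OF s4, of "alt_sign k"]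
    have "0 < (\<Sum>m\<in>{k}. exp (- t * (of_int m)\<^sup>2) + alt_sign k * (alt_sign m * exp (- t * (of_int m)\<^sup>2)))"
      by (simp add: alt_sign_def)
    also have "\<dots> \<le> (\<Sum>\<^sub>\<infinity>m. exp (- t * (of_int m)\<^sup>2) + alt_sign k * (alt_sign m * exp (- t * (of_int m)\<^sup>2)))"
      by (rule finite_sum_le_infsum[OF summable_on_add[OF s3 s4']]) (auto simp: alt_sign_def)
    also have "\<dots> = theta3 t + alt_sign k * theta4 t"
      unfolding theta3_def theta4_def infsum_add[OF s3 s4'] infsum_cmult_right' ..
    finally show ?thesis .
  qed
  show ?thesis using pos[of 0] pos[of 1] by (simp add: alt_sign_def)
qed

section \<open>Gaussian sums over the integer vectors\<close>

lemma norm_int_vec_squared: "(norm (int_vec m :: real ^ 'n::finite))\<^sup>2 = (\<Sum>i\<in>UNIV. (of_int (m i))\<^sup>2)"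
  by (simp add: norm_vec_def L2_set_def sum_nonneg)

lemma gaussian_abs_summable:
  assumes "t > 0"
  shows "Infinite_Sum.abs_summable_on (\<lambda>m. exp (- t * (norm (int_vec m :: real ^ 'n::finite))\<^sup>2)) UNIV"
proof -
  have "Infinite_Set_Sum.abs_summable_on (\<lambda>m::int. exp (- t * (real_of_int m)\<^sup>2)) UNIV"
    using theta3_abs_summable[OF assms] by (simp only: abs_summable_equivalent)
  then have "Infinite_Set_Sum.abs_summable_on (\<lambda>m. \<Prod>i\<in>(UNIV::'n set). exp (- t * (real_of_int (m i))\<^sup>2)) (PiE UNIV (\<lambda>_. UNIV))"
    by (intro abs_summable_on_prod_PiE) auto
  moreover have "(\<Prod>i\<in>(UNIV::'n set). exp (- t * (real_of_int (m i))\<^sup>2)) = exp (- t * (norm (int_vec m :: real ^ 'n))\<^sup>2)" for m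
    unfolding norm_int_vec_squared sum_distrib_left exp_sum[OF finite] ..
  ultimately show ?thesis
    by (simp only: abs_summable_equivalent PiE_UNIV_domain Pi_UNIV)
qed

text \<open>Both the sign and the Gaussian are products of one-variable functions, so the absolutely
  convergent sum factors over the coordinates.\<close>

lemma twisted_gaussian_sum:
  fixes S :: "'n::finite set"
  assumes t: "t > 0"
  shows "(\<Sum>\<^sub>\<infinity>m. (\<Prod>i\<in>S. alt_sign (m i)) * exp (- t * (norm (int_vec m :: real ^ 'n))\<^sup>2)) =
    theta4 t ^ card S * theta3 t ^ (CARD('n) - card S)"
proof -
  define g where "g = (\<lambda>i (k::int). (if i \<in> S then alt_sign k else 1) * exp (- t * (of_int k)\<^sup>2))"
  have "(\<Prod>i\<in>S. alt_sign (m i)) * exp (- t * (norm (int_vec m :: real ^ 'n))\<^sup>2) = (\<Prod>i\<in>UNIV. g i (m i))" for m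
  proof -
    have "(\<Prod>i\<in>S. alt_sign (m i)) = (\<Prod>i\<in>UNIV. if i \<in> S then alt_sign (m i) else 1)"
      by (simp add: prod.If_cases)
    then show ?thesis
      unfolding g_def prod.distrib norm_int_vec_squared sum_distrib_left exp_sum[OF finite] by simp
  qed
  then have "(\<Sum>\<^sub>\<infinity>m. (\<Prod>i\<in>S. alt_sign (m i)) * exp (- t * (norm (int_vec m :: real ^ 'n))\<^sup>2)) =
      infsum (\<lambda>m. \<Prod>i\<in>UNIV. g i (m i)) (PiE UNIV (\<lambda>_. UNIV))"
    by (simp add: PiE_UNIV_domain)
  also have "\<dots> = (\<Prod>i\<in>UNIV. infsum (g i) UNIV)"
  proof (rule infsum_prod_PiE_abs)
    show "Infinite_Sum.abs_summable_on (g i) UNIV" for i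
      using theta3_abs_summable[OF t] theta4_abs_summable[OF t] by (cases "i \<in> S") (simp_all add: g_def)
  qed simp
  also have "\<dots> = (\<Prod>i\<in>UNIV. if i \<in> S then theta4 t else theta3 t)"
    by (intro prod.cong) (auto simp: g_def theta3_def theta4_def)
  also have "\<dots> = theta4 t ^ card S * theta3 t ^ card (- S)"
    by (simp add: prod.If_cases)
  finally show ?thesis by (simp add: Compl_eq_Diff_UNIV card_Diff_subset)
qed

section \<open>Functions dominating the Gaussian\<close>

lemma nn_integral_lborel_translate:
  fixes f :: "'a::euclidean_space \<Rightarrow> ennreal"
  assumes [measurable]: "f \<in> borel_measurable borel"
  shows "(\<integral>\<^sup>+x. f (x + c) \<partial>lborel) = (\<integral>\<^sup>+x. f x \<partial>lborel)"
proof -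
  have "(\<integral>\<^sup>+x. f x \<partial>lborel) = (\<integral>\<^sup>+x. f x \<partial>distr lborel borel ((+) c))"
    by (simp add: lborel_distr_plus)
  also have "\<dots> = (\<integral>\<^sup>+x. f (c + x) \<partial>lborel)"
    by (subst nn_integral_distr) auto
  finally show ?thesis by (simp add: add.commute)
qed

lemma distr_lborel_uminus: "distr lborel borel uminus = (lborel :: 'a::euclidean_space measure)"
  using lborel_affine[of "- 1" "0 :: 'a"] by (simp add: density_1)

text \<open>Swapping the two integrations in \<open>\<integral>\<integral> 1\<^sub>A(x) 1\<^sub>B(x + y) dy dM(x)\<close> shows that a
  translation-invariant measure is proportional to Lebesgue measure; the unit ball fixes the
  factor.\<close>

lemma lborel_distr_orthogonal:
  fixes f :: "'a::euclidean_space \<Rightarrow> 'a"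
  assumes f: "orthogonal_transformation f"
  shows "distr lborel borel f = lborel"
proof (rule measure_eqI)
  interpret linear f using f by (rule orthogonal_transformation_linear)
  have [measurable]: "f \<in> borel_measurable borel"
    by (intro borel_measurable_continuous_onI linear_continuous_on linear_conv_bounded_linear[THEN iffD1] linear_axioms)
  have bij: "bij f" using f by (rule orthogonal_transformation_bij)
  show "sets (distr lborel borel f) = sets (lborel :: 'a measure)" by simp
  fix A :: "'a set"
  assume "A \<in> sets (distr lborel borel f)"
  then have [measurable]: "A \<in> sets borel" by simp
  define B :: "'a set" where "B = ball 0 1"
  have [measurable]: "B \<in> sets borel" by (simp add: B_def)
  have fB: "f x \<in> B \<longleftrightarrow> x \<in> B" for x
    using f by (simp add: B_def orthogonal_transformation_norm)
  have neg: "(\<integral>\<^sup>+x. indicator A (- x) \<partial>lborel) = emeasure lborel A"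
  proof -
    have "emeasure lborel A = emeasure (distr lborel borel uminus) A"
      by (simp add: distr_lborel_uminus)
    also have "\<dots> = (\<integral>\<^sup>+x. indicator A x \<partial>distr lborel borel uminus)" by simp
    also have "\<dots> = (\<integral>\<^sup>+x. indicator A (- x) \<partial>lborel)"
      by (subst nn_integral_distr) auto
    finally show ?thesis ..
  qed
  have "emeasure (distr lborel borel f) A * emeasure lborel B =
      (\<integral>\<^sup>+x. indicator A (f x) \<partial>lborel) * (\<integral>\<^sup>+y. indicator B y \<partial>lborel)"
  proof -
    have "emeasure (distr lborel borel f) A = (\<integral>\<^sup>+x. indicator A x \<partial>distr lborel borel f)" by simp
    also have "\<dots> = (\<integral>\<^sup>+x. indicator A (f x) \<partial>lborel)"
      by (subst nn_integral_distr) auto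
    finally show ?thesis by simp
  qed
  also have "\<dots> = (\<integral>\<^sup>+x. indicator A (f x) * (\<integral>\<^sup>+y. indicator B y \<partial>lborel) \<partial>lborel)"
    by (subst nn_integral_multc) auto
  also have "\<dots> = (\<integral>\<^sup>+x. (\<integral>\<^sup>+y. indicator A (f x) * indicator B (y + f x) \<partial>lborel) \<partial>lborel)"
    by (subst nn_integral_cmult) (auto simp: nn_integral_lborel_translate[of "indicator B"] intro!: nn_integral_cong)
  also have "\<dots> = (\<integral>\<^sup>+y. (\<integral>\<^sup>+x. indicator A (f x) * indicator B (y + f x) \<partial>lborel) \<partial>lborel)"
    by (rule lborel_pair.Fubini') measurable
  also have "\<dots> = (\<integral>\<^sup>+y. (\<integral>\<^sup>+x. indicator A (f x - y) * indicator B (f x) \<partial>lborel) \<partial>lborel)"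
  proof (rule nn_integral_cong)
    fix y :: 'a
    \<comment> \<open>Since \<open>f\<close> is linear, translating \<open>x\<close> by a preimage
      of \<open>y\<close> moves \<open>f x\<close> by \<open>y\<close>; here the translation
      invariance of the image measure enters.\<close>
    obtain z where z: "f z = y" using bij by (metis bij_pointE)
    show "(\<integral>\<^sup>+x. indicator A (f x) * indicator B (y + f x) \<partial>lborel) =
        (\<integral>\<^sup>+x. indicator A (f x - y) * indicator B (f x) \<partial>lborel)"
      by (subst nn_integral_lborel_translate[where c = z, symmetric,
          of "\<lambda>x. indicator A (f x - y) * indicator B (f x)"]) (auto simp: add z add.commute)
  qed
  also have "\<dots> = (\<integral>\<^sup>+x. (\<integral>\<^sup>+y. indicator A (f x - y) * indicator B (f x) \<partial>lborel) \<partial>lborel)"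
    by (rule lborel_pair.Fubini') measurable
  \<comment> \<open>For fixed \<open>x\<close>, translation and reflection in \<open>y\<close> turn
    the inner integral into the measure of \<open>A\<close>, and \<open>f\<close> preserves the unit
    ball \<open>B\<close>.\<close>
  also have "\<dots> = (\<integral>\<^sup>+x. emeasure lborel A * indicator B x \<partial>lborel)"
  proof (rule nn_integral_cong)
    fix x :: 'a
    have "(\<integral>\<^sup>+y. indicator A (f x - y) * indicator B (f x) \<partial>lborel) =
      (\<integral>\<^sup>+y. indicator A (f x - y) \<partial>lborel) * indicator B (f x)"
      by (rule nn_integral_multc) measurable
    also have "(\<integral>\<^sup>+y. indicator A (f x - y) \<partial>lborel) = (\<integral>\<^sup>+y. indicator A (- y) \<partial>lborel)"
      by (subst nn_integral_lborel_translate[where c = "f x", symmetric]) auto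
    moreover have "indicator B (f x) = (indicator B x :: ennreal)" using fB by (simp add: indicator_def)
    ultimately show "(\<integral>\<^sup>+y. indicator A (f x - y) * indicator B (f x) \<partial>lborel) =
        emeasure lborel A * indicator B x"
      by (simp only: neg)
  qed
  also have "\<dots> = emeasure lborel A * emeasure lborel B"
    by (subst nn_integral_cmult) auto
  finally have "emeasure (distr lborel borel f) A * emeasure lborel B = emeasure lborel A * emeasure lborel B" .
  moreover have "emeasure lborel B \<noteq> 0" "emeasure lborel B \<noteq> \<infinity>"
    unfolding B_def using unit_ball_vol_pos[of "real DIM('a)"] by (simp_all add: emeasure_ball less_imp_neq[symmetric])
  ultimately show "emeasure (distr lborel borel f) A = emeasure lborel A"
    by (simp add: mult.commute[of _ "emeasure lborel B"] ennreal_mult_cancel_left)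
qed

section \<open>Schwartz functions on rotated lattices\<close>

lemma schwartz_continuous: "schwartz h \<Longrightarrow> continuous_on UNIV h"
proof -
  assume "schwartz h"
  then have "iter_deriv [] h differentiable (at x)" for x
    unfolding schwartz_def by (metis lists.Nil)
  then show ?thesis
    by (simp add: continuous_at_imp_continuous_on differentiable_imp_continuous_within)
qed

lemma decay_weight_ge: "1 / (1 + (norm x)\<^sup>2) ^ CARD('n) \<le> decay_weight (x :: real ^ 'n::finite)"
proof -
  have "(\<Prod>i\<in>(UNIV::'n set). 1 / (1 + (norm x)\<^sup>2)) \<le> decay_weight x"
    unfolding decay_weight_def
  proof (intro prod_mono conjI divide_left_mono add_left_mono)
    fix i
    have "\<bar>vec_nth x i\<bar> \<le> norm x" by (rule component_le_norm_cart)
    then show "(vec_nth x i)\<^sup>2 \<le> (norm x)\<^sup>2" by (metis abs_ge_zero power2_abs power_mono)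
  qed (simp_all add: add_pos_nonneg)
  then show ?thesis by (simp add: power_one_over)
qed

text \<open>Two vectors of equal norm appear so that one constant serves \<open>h\<close> and all
  its rotations.\<close>

lemma schwartz_decay:
  fixes h :: "real ^ 'n::finite \<Rightarrow> real"
  assumes "schwartz h"
  obtains C where "\<And>x y :: real ^ 'n. norm x = norm y \<Longrightarrow> \<bar>h x\<bar> \<le> C * decay_weight y"
proof -
  define n where "n = CARD('n)"
  have bnd: "bounded (range (\<lambda>x. norm x ^ k * h x))" for k
    using assms unfolding schwartz_def by (metis iter_deriv.simps(1) lists.Nil)
  obtain A where A: "\<And>x. \<bar>norm x ^ 0 * h x\<bar> \<le> A" using bnd[of 0] unfolding bounded_iff by auto
  obtain B where B: "\<And>x. \<bar>norm x ^ (2 * n) * h x\<bar> \<le> B" using bnd[of "2 * n"] unfolding bounded_iff by auto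
  \<comment> \<open>Reduces the weight to the powers of the norm with exponents 0 and
    \<open>2 * n\<close>, for which \<open>A\<close> and \<open>B\<close> are the bounds.\<close>
  have pow: "(1 + y) ^ n \<le> 2 ^ n * (1 + y ^ n)" if "y \<ge> 0" for y :: real
  proof -
    have "(1 + y) ^ n \<le> (2 * max 1 y) ^ n" using that by (intro power_mono) auto
    also have "\<dots> = 2 ^ n * max 1 y ^ n" by (simp add: power_mult_distrib)
    also have "\<dots> \<le> 2 ^ n * (1 + y ^ n)" using that by (intro mult_left_mono) (auto simp: max_def)
    finally show ?thesis .
  qed
  have "\<bar>h x\<bar> \<le> 2 ^ n * (A + B) * decay_weight y" if xy: "norm x = norm y" for x y :: "real ^ 'n"
  proof -
    have pos: "(1 + (norm y)\<^sup>2) ^ n > 0" by (simp add: add_pos_nonneg)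
    have "(1 + (norm y)\<^sup>2) ^ n * \<bar>h x\<bar> \<le> 2 ^ n * (1 + ((norm y)\<^sup>2) ^ n) * \<bar>h x\<bar>"
      by (intro mult_right_mono pow) auto
    also have "\<dots> = 2 ^ n * (\<bar>norm x ^ 0 * h x\<bar> + \<bar>norm x ^ (2 * n) * h x\<bar>)"
      by (simp add: xy power_mult[symmetric] abs_mult algebra_simps)
    also have "\<dots> \<le> 2 ^ n * (A + B)" using A[of x] B[of x] by (intro mult_left_mono add_mono) auto
    finally have "\<bar>h x\<bar> \<le> 2 ^ n * (A + B) * (1 / (1 + (norm y)\<^sup>2) ^ n)"
      using pos by (simp add: field_simps)
    also have "\<dots> \<le> 2 ^ n * (A + B) * decay_weight y"
    proof (rule mult_left_mono)
      show "1 / (1 + (norm y)\<^sup>2) ^ n \<le> decay_weight y" unfolding n_def by (rule decay_weight_ge)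
      have "0 \<le> A + B" using A[of 0] B[of 0] by linarith
      then show "0 \<le> 2 ^ n * (A + B)" by simp
    qed
    finally show ?thesis .
  qed
  then show thesis by (rule that)
qed

lemma fourier_eq_fourier_complex: "fourier h \<xi> = fourier_complex (\<lambda>x. of_real (h x)) \<xi>"
  unfolding fourier_def fourier_complex_def
  by (intro Bochner_Integration.integral_cong refl) (simp add: cis_conv_exp mult_ac)

text \<open>Change of variables: \<open>f\<close> preserves both Lebesgue measure and the inner
  product in the phase.\<close>

lemma fourier_complex_orthogonal:
  fixes f :: "'a::euclidean_space \<Rightarrow> 'a"
  assumes f: "orthogonal_transformation f" and [measurable]: "F \<in> borel_measurable borel"
  shows "fourier_complex (\<lambda>x. F (f x)) \<xi> = fourier_complex F (f \<xi>)"
proof -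
  have [measurable]: "f \<in> borel_measurable borel"
    using orthogonal_transformation_linear[OF f]
    by (intro borel_measurable_continuous_onI linear_continuous_on) (simp add: linear_conv_bounded_linear)
  have [measurable]: "cis \<in> borel_measurable borel"
    by (intro borel_measurable_continuous_onI continuous_intros)
  have "fourier_complex F (f \<xi>) = (LINT y|distr lborel borel f. F y * cis (- 2 * pi * inner y (f \<xi>)))"
    unfolding fourier_complex_def lborel_distr_orthogonal[OF f] ..
  also have "\<dots> = (LINT x|lborel. F (f x) * cis (- 2 * pi * inner (f x) (f \<xi>)))"
    by (rule integral_distr) measurable
  also have "\<dots> = fourier_complex (\<lambda>x. F (f x)) \<xi>"
    using f by (simp add: fourier_complex_def orthogonal_transformation_def)
  finally show ?thesis ..
qed

lemma gaussian_mass_standard_lattice: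
  "gaussian_mass (standard_lattice :: (real ^ 'n::finite) set) t =
    (\<Sum>\<^sub>\<infinity>m. exp (- t * (norm (int_vec m :: real ^ 'n))\<^sup>2))"
  unfolding gaussian_mass_def standard_lattice_eq
  by (rule infsum_reindex_bij_betw[symmetric]) (simp add: bij_betw_def inj_int_vec)

lemma schwartz_lattice_abs_summable:
  fixes h :: "real ^ 'n::finite \<Rightarrow> real" and f :: "real ^ 'n \<Rightarrow> real ^ 'n"
  assumes "schwartz h" and f: "orthogonal_transformation f"
  shows "Infinite_Sum.abs_summable_on (\<lambda>m. h (f (int_vec m))) UNIV"
proof -
  obtain C where C: "\<And>x y :: real ^ 'n. norm x = norm y \<Longrightarrow> \<bar>h x\<bar> \<le> C * decay_weight y"
    using schwartz_decay[OF assms(1)] by blast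
  have "Infinite_Set_Sum.abs_summable_on (\<lambda>m. C * decay_weight (int_vec m :: real ^ 'n)) UNIV"
    by (intro abs_summable_on_cmult_right decay_weight_abs_summable)
  then have "Infinite_Sum.abs_summable_on (\<lambda>m. C * decay_weight (int_vec m :: real ^ 'n)) UNIV"
    by (simp only: abs_summable_equivalent)
  then show ?thesis
  proof (rule Infinite_Sum.abs_summable_on_comparison_test[where f = "\<lambda>m. h (f (int_vec m))"])
    fix m :: "'n \<Rightarrow> int"
    have "\<bar>h (f (int_vec m))\<bar> \<le> C * decay_weight (int_vec m :: real ^ 'n)"
      using C orthogonal_transformation_norm[OF f] by blast
    then show "norm (h (f (int_vec m))) \<le> norm (C * decay_weight (int_vec m :: real ^ 'n))" by simp
  qed
qed

lemma fourier_rotated: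
  fixes h :: "real ^ 'n::finite \<Rightarrow> real" and f :: "real ^ 'n \<Rightarrow> real ^ 'n"
  assumes "schwartz h" and f: "orthogonal_transformation f"
  shows "fourier_complex (\<lambda>x. of_real (h (f x))) \<xi> = fourier h (f \<xi>)"
proof -
  have [measurable]: "h \<in> borel_measurable borel"
    using schwartz_continuous[OF assms(1)] by (rule borel_measurable_continuous_onI)
  show ?thesis
    unfolding fourier_eq_fourier_complex by (rule fourier_complex_orthogonal[OF f]) measurable
qed

text \<open>Poisson summation over the rotated lattice, keeping on each side only the terms belonging
  to one nonzero lattice vector.\<close>

lemma gaussian_excess_le:
  fixes h :: "real ^ 'n::finite \<Rightarrow> real" and f :: "real ^ 'n \<Rightarrow> real ^ 'n"
  assumes t: "t > 0" and h: "schwartz h" "dominates_gaussian t h" "fourier_nonpos h"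
    and f: "orthogonal_transformation f" and k: "k \<noteq> (\<lambda>_. 0)"
  shows "h (f (int_vec k)) - exp (- t * (norm (f (int_vec k)))\<^sup>2) \<le>
    (1 + Re (fourier h 0) - h 0 - gaussian_mass (standard_lattice :: (real ^ 'n) set) t) +
    Re (fourier h (f (int_vec k)))"
proof -
  have f0: "f 0 = 0" using orthogonal_transformation_linear[OF f] by (rule linear_0)
  have nf: "norm (f x) = norm x" for x using f by (rule orthogonal_transformation_norm)
  have cont: "continuous_on UNIV (\<lambda>x. complex_of_real (h (f x)))"
  proof -
    have "continuous_on UNIV f"
      using orthogonal_transformation_linear[OF f] by (intro linear_continuous_on) (simp add: linear_conv_bounded_linear)
    then show ?thesis
      by (intro continuous_on_of_real continuous_on_compose2[OF schwartz_continuous[OF h(1)]]) auto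
  qed
  obtain C where C: "\<And>x y :: real ^ 'n. norm x = norm y \<Longrightarrow> \<bar>h x\<bar> \<le> C * decay_weight y"
    using schwartz_decay[OF h(1)] by blast
  have nonpos: "Re (fourier h (f (int_vec m))) \<le> 0" if "m \<noteq> (\<lambda>_. 0)" for m
  proof -
    have "f (int_vec m) \<in> f ` standard_lattice" by (simp add: standard_lattice_eq)
    moreover have "f (int_vec m) \<noteq> 0" using that nf by (metis int_vec_eq_0_iff norm_eq_zero)
    ultimately show ?thesis
      using h(3) stable_orthogonal_image[OF f] orthogonal_image_subset_dual[OF f]
      unfolding fourier_nonpos_def by blast
  qed
  have dom: "exp (- t * (norm (int_vec m :: real ^ 'n))\<^sup>2) \<le> h (f (int_vec m))" if "m \<noteq> (\<lambda>_. 0)" for m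
  proof -
    have "f (int_vec m) \<in> f ` standard_lattice" by (simp add: standard_lattice_eq)
    moreover have "f (int_vec m) \<noteq> 0" using that nf by (metis int_vec_eq_0_iff norm_eq_zero)
    ultimately have "h (f (int_vec m)) \<ge> exp (- t * (norm (f (int_vec m)))\<^sup>2)"
      using h(2) stable_orthogonal_image[OF f] unfolding dominates_gaussian_def by blast
    then show ?thesis by (simp add: nf)
  qed
  define g where "g = (\<lambda>m. exp (- t * (norm (int_vec m :: real ^ 'n))\<^sup>2))"
  have sg: "g summable_on UNIV"
    unfolding g_def by (rule abs_summable_summable[OF gaussian_abs_summable[OF t]])
  have sh: "(\<lambda>m. h (f (int_vec m))) summable_on UNIV"
    by (rule abs_summable_summable[OF schwartz_lattice_abs_summable[OF h(1) f]])
  have sd: "(\<lambda>m. h (f (int_vec m)) + - g m) summable_on UNIV"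
    by (intro summable_on_add sh summable_on_uminus[THEN iffD2] sg)
  have "(h 0 - 1) + (h (f (int_vec k)) - g k) = (\<Sum>m\<in>{(\<lambda>_. 0), k}. h (f (int_vec m)) + - g m)"
    using k by (simp add: f0 g_def)
  also have "\<dots> \<le> (\<Sum>\<^sub>\<infinity>m. h (f (int_vec m)) + - g m)"
    using dom by (intro finite_sum_le_infsum sd) (auto simp: g_def)
  also have "\<dots> = (\<Sum>\<^sub>\<infinity>m. h (f (int_vec m))) - infsum g UNIV"
    by (subst infsum_add[OF sh summable_on_uminus[THEN iffD2, OF sg]]) (simp add: infsum_uminus)
  also have "(\<Sum>\<^sub>\<infinity>m. h (f (int_vec m))) = Re (\<Sum>\<^sub>\<infinity>m. complex_of_real (h (f (int_vec m))))"
    by (subst infsum_Re[symmetric]) (use sh in \<open>simp_all add: summable_on_of_real\<close>)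
  \<comment> \<open>Here (ii') enters, through \<open>nonpos\<close>, since the transform of the
    rotated function is the rotated transform.\<close>
  also have "\<dots> \<le> Re (fourier_complex (\<lambda>x. of_real (h (f x))) 0) + Re (fourier_complex (\<lambda>x. of_real (h (f x))) (int_vec k))"
    by (rule poisson_le[OF cont _ _ k, where C = C])
      (use C nf nonpos in \<open>simp_all add: fourier_rotated[OF h(1) f]\<close>)
  finally show ?thesis
    unfolding fourier_rotated[OF h(1) f] f0 gaussian_mass_standard_lattice nf g_def by linarith
qed

text \<open>In the equality case the bracket in the excess estimate vanishes. The remaining left
  side is nonnegative by (i') and the right side nonpositive by (ii'), so both are 0.\<close>

lemma gaussian_excess_zero:
  fixes h :: "real ^ 'n::finite \<Rightarrow> real" and f :: "real ^ 'n \<Rightarrow> real ^ 'n"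
  assumes t: "t > 0" and h: "schwartz h" "even_fun h" "dominates_gaussian t h" "fourier_nonpos h"
    and eq: "1 + Re (fourier h 0) - h 0 = gaussian_mass (standard_lattice :: (real ^ 'n) set) t"
    and f: "orthogonal_transformation f" and k: "k \<noteq> (\<lambda>_. 0)"
  shows "h (f (int_vec k)) = exp (- t * (norm (f (int_vec k)))\<^sup>2)" "fourier h (f (int_vec k)) = 0"
proof -
  have le: "h (f (int_vec k)) - exp (- t * (norm (f (int_vec k)))\<^sup>2) \<le> Re (fourier h (f (int_vec k)))"
    using gaussian_excess_le[OF t h(1,3,4) f k] eq by simp
  have mem: "f (int_vec k) \<in> f ` standard_lattice" by (simp add: standard_lattice_eq)
  have nz: "f (int_vec k) \<noteq> 0"
    using k orthogonal_transformation_norm[OF f] by (metis int_vec_eq_0_iff norm_eq_zero)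
  have "h (f (int_vec k)) \<ge> exp (- t * (norm (f (int_vec k)))\<^sup>2)"
    using h(3) stable_orthogonal_image[OF f] mem nz unfolding dominates_gaussian_def by blast
  moreover have "Re (fourier h (f (int_vec k))) \<le> 0"
    using h(4) stable_orthogonal_image[OF f] orthogonal_image_subset_dual[OF f] mem nz
    unfolding fourier_nonpos_def by blast
  ultimately have "h (f (int_vec k)) = exp (- t * (norm (f (int_vec k)))\<^sup>2)" "Re (fourier h (f (int_vec k))) = 0"
    using le by linarith+
  \<comment> \<open>(ii') speaks of the real part; the imaginary part vanishes by evenness.\<close>
  moreover have "Im (fourier h (f (int_vec k))) = 0"
    using fourier_real[OF h(1,2)] by (simp add: complex_is_Real_iff)
  ultimately show "h (f (int_vec k)) = exp (- t * (norm (f (int_vec k)))\<^sup>2)" "fourier h (f (int_vec k)) = 0"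
    by (simp_all add: complex_eq_iff)
qed

section \<open>Vectors of integer square norm\<close>

lemma exists_int_vec_norm_squared:
  fixes n :: nat
  assumes "CARD('n::finite) \<ge> 4"
  obtains k where "(norm (int_vec k :: real ^ 'n))\<^sup>2 = real n"
proof -
  obtain a b c d where abcd: "int n = a\<^sup>2 + b\<^sup>2 + c\<^sup>2 + d\<^sup>2"
    using four_squares[of n] unfolding sum4sq_def by blast
  obtain T :: "'n set" where "card T = 4" using obtain_subset_with_card_n[OF assms] by blast
  then obtain p q r s where T: "T = {p, q, r, s}" "distinct [p, q, r, s]"
    by (auto simp: numeral_eq_Suc card_Suc_eq)
  \<comment> \<open>The four squares sit in four chosen coordinates, and all others are 0.\<close>
  define k where "k = (\<lambda>_. 0)(p := a, q := b, r := c, s := d)"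
  have "(norm (int_vec k :: real ^ 'n))\<^sup>2 = (\<Sum>i\<in>T. (of_int (k i))\<^sup>2)"
    unfolding norm_int_vec_squared by (rule sum.mono_neutral_right) (auto simp: T(1) k_def)
  also have "\<dots> = of_int (a\<^sup>2 + b\<^sup>2 + c\<^sup>2 + d\<^sup>2)"
    using T by (auto simp: k_def)
  also have "\<dots> = real n" by (simp flip: abcd)
  finally show thesis by (rule that)
qed

text \<open>By the four-square theorem some integer vector has the norm of \<open>x\<close>, and an
  orthogonal map takes it to \<open>x\<close>; the equality case for that rotated lattice gives both
  values.\<close>

lemma sharp_on_integer_norms:
  fixes h :: "real ^ 'n::finite \<Rightarrow> real"
  assumes n: "CARD('n) \<ge> 4" and t: "t > 0"
    and h: "schwartz h" "even_fun h" "dominates_gaussian t h" "fourier_nonpos h"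
    and eq: "1 + Re (fourier h 0) - h 0 = gaussian_mass (standard_lattice :: (real ^ 'n) set) t"
    and x: "x \<noteq> 0" "(norm x)\<^sup>2 \<in> \<int>"
  shows "h x = exp (- t * (norm x)\<^sup>2)" "fourier h x = 0"
proof -
  obtain z where "(norm x)\<^sup>2 = of_int z" using x(2) by (auto elim: Ints_cases)
  moreover have "z \<ge> 0" using calculation by (metis of_int_0_le_iff zero_le_power2)
  ultimately have "(norm x)\<^sup>2 = real (nat z)" by simp
  then obtain k where k: "(norm (int_vec k :: real ^ 'n))\<^sup>2 = (norm x)\<^sup>2"
    using exists_int_vec_norm_squared[OF n] by metis
  then have norm: "norm (int_vec k :: real ^ 'n) = norm x" by simp
  then have "k \<noteq> (\<lambda>_. 0)" using x(1) by auto
  moreover obtain f where f: "orthogonal_transformation f" "f (int_vec k) = x"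
    using orthogonal_transformation_exists[OF norm] by blast
  ultimately show "h x = exp (- t * (norm x)\<^sup>2)" "fourier h x = 0"
    using gaussian_excess_zero[OF t h eq f(1)] by auto
qed

section \<open>The sign twist and the contradiction\<close>

lemma cis_pi_of_int: "cis (pi * of_int m) = of_real (alt_sign m)"
  by (cases "even m") (auto simp: alt_sign_def cis_conv_exp complex_eq_iff Re_exp Im_exp elim!: evenE oddE)

text \<open>The lattice shifted by half the indicator vector of a set of \<open>4\<close> or \<open>8\<close> coordinates still
  has integer square norms, so the Fourier side of the twisted Poisson sum vanishes.\<close>

lemma twisted_sum_zero:
  fixes h :: "real ^ 'n::finite \<Rightarrow> real" and S :: "'n set"
  assumes n: "CARD('n) \<ge> 4" and t: "t > 0"
    and h: "schwartz h" "even_fun h" "dominates_gaussian t h" "fourier_nonpos h"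
    and eq: "1 + Re (fourier h 0) - h 0 = gaussian_mass (standard_lattice :: (real ^ 'n) set) t"
    and S: "4 dvd card S" "S \<noteq> {}"
  shows "theta4 t ^ card S * theta3 t ^ (CARD('n) - card S) = 1 - h 0"
proof -
  \<comment> \<open>Modulation by this vector gives the sign character \<open>\<sigma>\<close> on
    integer vectors and shifts the frequencies by \<open>a\<close>.\<close>
  define a :: "real ^ 'n" where "a = (\<chi> i. if i \<in> S then 1 / 2 else 0)"
  define F where "F = (\<lambda>x. complex_of_real (h x) * cis (2 * pi * inner x a))"
  define \<sigma> where "\<sigma> = (\<lambda>m :: 'n \<Rightarrow> int. \<Prod>i\<in>S. alt_sign (m i))"
  have abs_\<sigma>: "\<bar>\<sigma> m\<bar> = 1" for m by (simp add: \<sigma>_def abs_prod)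
  obtain C where C: "\<And>x y :: real ^ 'n. norm x = norm y \<Longrightarrow> \<bar>h x\<bar> \<le> C * decay_weight y"
    using schwartz_decay[OF h(1)] by blast
  have "infsum (\<lambda>m. F (int_vec m)) UNIV = 0"
  proof (rule poisson_zero)
    show "continuous_on UNIV F"
      unfolding F_def using schwartz_continuous[OF h(1)] by (intro continuous_intros)
    show "norm (F x) \<le> C * decay_weight x" for x
      using C[of x x] by (simp add: F_def norm_mult)
    fix k :: "'n \<Rightarrow> int"
    have "fourier_complex F (int_vec k) = fourier_complex (\<lambda>x. of_real (h x)) (int_vec k - a)"
      unfolding fourier_complex_def F_def
      by (intro Bochner_Integration.integral_cong refl) (simp add: mult.assoc cis_mult inner_diff_right algebra_simps)
    also have "\<dots> = fourier h (int_vec k - a)" by (rule fourier_eq_fourier_complex[symmetric])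
    also have "\<dots> = 0"
    proof (rule sharp_on_integer_norms[OF n t h eq])
      \<comment> \<open>Coordinates in \<open>S\<close> become half-integers, so the shifted
        frequency is never 0, the one point where sharpness says nothing.\<close>
      obtain i where i: "i \<in> S" using S(2) by blast
      have "real_of_int (k i) \<noteq> 1 / 2"
      proof
        assume "real_of_int (k i) = 1 / 2"
        then have "real_of_int (2 * k i) = of_int 1" by simp
        then have "2 * k i = 1" by (simp only: of_int_eq_iff)
        then show False by presburger
      qed
      then have "vec_nth (int_vec k - a) i \<noteq> 0" using i by (simp add: a_def)
      then show "int_vec k - a \<noteq> 0" by (metis zero_index)
      obtain q where q: "card S = 4 * q" using S(1) by blast
      have "(norm (int_vec k - a))\<^sup>2 = (\<Sum>i\<in>UNIV. (vec_nth (int_vec k - a) i)\<^sup>2)"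
        by (simp add: norm_vec_def L2_set_def sum_nonneg)
      \<comment> \<open>On \<open>S\<close> each square is
        \<open>(k i)\<^sup>2 - k i + 1 / 4\<close>, and the \<open>4 * q\<close> quarters add up to
        the integer \<open>q\<close>.\<close>
      also have "\<dots> = (\<Sum>i\<in>UNIV. of_int ((k i)\<^sup>2 - (if i \<in> S then k i else 0)) + (if i \<in> S then 1 / 4 else 0))"
        by (intro sum.cong) (auto simp: a_def power2_eq_square algebra_simps)
      also have "\<dots> = of_int (\<Sum>i\<in>UNIV. (k i)\<^sup>2 - (if i \<in> S then k i else 0)) + real q"
        unfolding sum.distrib by (simp add: sum.If_cases q)
      also have "\<dots> \<in> \<int>" by (intro Ints_add) auto
      finally show "(norm (int_vec k - a))\<^sup>2 \<in> \<int>" .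
    qed
    finally show "fourier_complex F (int_vec k) = 0" .
  qed
  moreover have "F (int_vec m) = of_real (\<sigma> m * h (int_vec m))" for m
  proof -
    have "2 * pi * inner (int_vec m) a = (\<Sum>i\<in>UNIV. if i \<in> S then pi * of_int (m i) else 0)"
      unfolding inner_vec_def sum_distrib_left by (intro sum.cong) (auto simp: a_def)
    also have "\<dots> = (\<Sum>i\<in>S. pi * of_int (m i))" by (simp add: sum.If_cases)
    finally have "cis (2 * pi * inner (int_vec m) a) = (\<Prod>i\<in>S. cis (pi * of_int (m i)))"
      by (simp add: prod_cis)
    then show ?thesis by (simp add: F_def cis_pi_of_int \<sigma>_def)
  qed
  moreover have id: "orthogonal_transformation (id :: real ^ 'n \<Rightarrow> real ^ 'n)"
    by (rule orthogonal_transformation_id[unfolded id_def[symmetric]])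
  have sh: "(\<lambda>m. \<sigma> m * h (int_vec m)) summable_on UNIV"
    using schwartz_lattice_abs_summable[OF h(1) id]
    by (intro abs_summable_summable[of "\<lambda>m. \<sigma> m * h (int_vec m)"]) (simp add: abs_mult abs_\<sigma>)
  ultimately have "(\<Sum>\<^sub>\<infinity>m. complex_of_real (\<sigma> m * h (int_vec m))) = 0" by simp
  then have zero: "(\<Sum>\<^sub>\<infinity>m. \<sigma> m * h (int_vec m)) = 0"
    using infsum_Re[OF summable_on_of_real[OF sh]] by simp
  define g where "g = (\<lambda>m. exp (- t * (norm (int_vec m :: real ^ 'n))\<^sup>2))"
  have "h (int_vec m) = g m" if "m \<noteq> (\<lambda>_. 0)" for m
    using gaussian_excess_zero(1)[OF t h eq id that] by (simp add: g_def)
  \<comment> \<open>\<open>h\<close> and the Gaussian agree at nonzero integer vectors; at 0, where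
    the sign is 1, they differ by \<open>1 - h 0\<close>.\<close>
  then have diff: "\<sigma> m * g m = \<sigma> m * h (int_vec m) + (if m = (\<lambda>_. 0) then 1 - h 0 else 0)" for m
    by (auto simp: g_def \<sigma>_def alt_sign_def)
  have delta: "((\<lambda>m::'n \<Rightarrow> int. if m = (\<lambda>_. 0) then 1 - h 0 else 0) has_sum (1 - h 0)) UNIV"
    by (rule has_sum_finite_neutralI[where B = "{\<lambda>_. 0}"]) auto
  have "(\<Sum>\<^sub>\<infinity>m. \<sigma> m * g m) = 1 - h 0"
    unfolding diff using infsumI[OF has_sum_add[OF has_sum_infsum[OF sh] delta]] zero by simp
  then show ?thesis
    using twisted_gaussian_sum[OF t, of S] by (simp add: g_def \<sigma>_def)
qed

text \<open>Twists by 8 and by 4 coordinates yield the same value \<open>1 - h 0\<close>. Cancelling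
  the nonzero factor \<open>theta4 t ^ 4 * theta3 t ^ (CARD('n) - 8)\<close> leaves an equality of
  fourth powers that \<open>\<bar>theta4 t\<bar> < theta3 t\<close> excludes.\<close>

lemma no_sharp_function:
  fixes h :: "real ^ 'n::finite \<Rightarrow> real"
  assumes n: "CARD('n) \<ge> 8" and t: "t > 0"
    and h: "schwartz h" "even_fun h" "dominates_gaussian t h" "fourier_nonpos h"
  shows "1 + Re (fourier h 0) - h 0 \<noteq> gaussian_mass (standard_lattice :: (real ^ 'n) set) t"
proof
  assume eq: "1 + Re (fourier h 0) - h 0 = gaussian_mass (standard_lattice :: (real ^ 'n) set) t"
  have n4: "CARD('n) \<ge> 4" using n by simp
  obtain S :: "'n set" where S: "card S = 8" using obtain_subset_with_card_n[OF n] by blast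
  obtain T :: "'n set" where T: "card T = 4" using obtain_subset_with_card_n[OF n4] by blast
  have "theta4 t ^ 8 * theta3 t ^ (CARD('n) - 8) = theta4 t ^ 4 * theta3 t ^ (CARD('n) - 4)"
    using twisted_sum_zero[OF n4 t h eq, of S] twisted_sum_zero[OF n4 t h eq, of T] S T by force
  \<comment> \<open>Subtraction is truncated, so the exponents match only from 8 coordinates
    on.\<close>
  moreover have "theta3 t ^ (CARD('n) - 4) = theta3 t ^ 4 * theta3 t ^ (CARD('n) - 8)"
    using n by (simp flip: power_add)
  moreover have "theta4 t ^ 8 = theta4 t ^ 4 * theta4 t ^ 4"
    by (simp flip: power_add)
  ultimately have "theta4 t ^ 4 * theta3 t ^ (CARD('n) - 8) * theta4 t ^ 4 =
      theta4 t ^ 4 * theta3 t ^ (CARD('n) - 8) * theta3 t ^ 4"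
    by (simp only: mult_ac)
  moreover have "theta3 t > 0" using abs_theta4_less_theta3[OF t] by linarith
  ultimately have "theta4 t ^ 4 = theta3 t ^ 4" using theta4_nonzero[OF t] by simp
  moreover have "\<bar>theta4 t\<bar> ^ 4 < theta3 t ^ 4"
    using abs_theta4_less_theta3[OF t] by (intro power_strict_mono) auto
  ultimately show False by simp
qed

theorem corollary5p1:
  fixes t :: real
  assumes "t > 0"
  shows
    "(CARD('n::finite) \<ge> 4 \<longrightarrow>
       (\<forall>h :: real ^ 'n \<Rightarrow> real.
          schwartz h \<and> even_fun h \<and> dominates_gaussian t h \<and> fourier_nonpos h \<and>
          1 + Re (fourier h 0) - h 0 = gaussian_mass (standard_lattice :: (real ^ 'n) set) t \<longrightarrow>
          (\<forall>x. x \<noteq> 0 \<and> (norm x)\<^sup>2 \<in> \<int> \<longrightarrow>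
             h x = exp (- t * (norm x)\<^sup>2) \<and> fourier h x = 0))) \<and>
     (CARD('n) \<ge> 8 \<longrightarrow>
       (\<forall>h :: real ^ 'n \<Rightarrow> real.
          schwartz h \<and> even_fun h \<and> dominates_gaussian t h \<and> fourier_nonpos h \<longrightarrow>
          1 + Re (fourier h 0) - h 0 > gaussian_mass (standard_lattice :: (real ^ 'n) set) t)) \<and>
     (CARD('n) \<ge> 8 \<longrightarrow>
       \<not> (\<exists>h :: real ^ 'n \<Rightarrow> real.
          schwartz h \<and> even_fun h \<and> dominates_gaussian t h \<and> fourier_nonpos h \<and>
          1 + Re (fourier h 0) - h 0 = gaussian_mass (standard_lattice :: (real ^ 'n) set) t))"
proof -
  have weak: "gaussian_mass (standard_lattice :: (real ^ 'n) set) t \<le> 1 + Re (fourier h 0) - h 0"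
    if h: "schwartz h" "dominates_gaussian t h" "fourier_nonpos h" for h :: "real ^ 'n \<Rightarrow> real"
  proof -
    have id: "orthogonal_transformation (id :: real ^ 'n \<Rightarrow> real ^ 'n)"
      by (rule orthogonal_transformation_id[unfolded id_def[symmetric]])
    have one: "(\<lambda>_::'n. 1::int) \<noteq> (\<lambda>_. 0)" by (simp add: fun_eq_iff)
    \<comment> \<open>A sample nonzero integer vector: by (i') the left side of the excess estimate
      is nonnegative there, and by (ii') the transform term is nonpositive.\<close>
    define x :: "real ^ 'n" where "x = int_vec (\<lambda>_. 1)"
    have "x \<in> id ` standard_lattice" "x \<noteq> 0"
      using one by (auto simp: x_def standard_lattice_eq int_vec_eq_0_iff)
    then have "exp (- t * (norm x)\<^sup>2) \<le> h x" "Re (fourier h x) \<le> 0"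
      using h stable_orthogonal_image[OF id] orthogonal_image_subset_dual[OF id]
      unfolding dominates_gaussian_def fourier_nonpos_def by blast+
    then show ?thesis
      using gaussian_excess_le[OF assms h id one] by (simp add: x_def)
  qed
  \<comment> \<open>Strictness in (2) is the weak inequality combined with the impossibility of
    equality.\<close>
  show ?thesis
    using sharp_on_integer_norms[OF _ assms] no_sharp_function[OF _ assms] weak
    by (metis order_le_neq_trans)
qed

end
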